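(* Let $m\ge 1$, let $x_1,\ldots,x_m\ge 0$ be real numbers, and put $p_i=\frac{x_i}{1+x_i}\in[0,1)$. Let $\Lambda$ be the random partition attached to the random set of top exit positions of the row-inhomogeneous stochastic rational six-vertex model with row parameters $p_1,\ldots,p_m$, one path entering from the left in every row, and no paths entering from below. Then for every partition $\lambda$ with $\ell(\lambda)\le m$, $$\mathbb P(\Lambda=\lambda)=\tilde s_\lambda(x_1,\ldots,x_m).$$
   Context: The functions $\tilde s_\lambda$. For $m\ge1$ and a partition $\lambda$ with $\ell(\lambda)\le m$ put $i_a=\lambda_{m+1-a}+a$ for $1\le a\le m$; then $1\le i_1<\cdots<i_m$. This identifies partitions of length at most $m$ with $m$-element sets $I=\{i_1<\cdots<i_m\}$ of positive integers. The (finite evaluation of the) stable Segre-Schwartz-MacPherson function $\tilde s_\lambda$ is $$\tilde s_\lambda(x_1,\ldots,x_m)=\sum_{w\in S_m} w\left[\prod_{u=1}^m\frac{x_u^{i_u-1}}{(1+x_u)^{i_u}}\prod_{1\le u<v\le m}\frac{1+x_v-x_u}{x_v-x_u}\right],$$ where $w\in S_m$ permutes the variables $x_1,\ldots,x_m$. The apparent poles at $x_u=x_v$ cancel, so this is a symmetric polynomial divided by a product of powers of the $1+x_u$, and it can be evaluated at all $x_1,\ldots,x_m\ge0$. The six-vertex model. Consider a strip with rows $1,\ldots,m$ (from bottom to top) and columns $1,2,3,\ldots$ (from left to right). Every edge is occupied or unoccupied (bit $1$ or $0$). Each row has one occupied horizontal edge entering from the left at column $1$; all vertical edges entering row $1$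 from below are unoccupied. The vertices are updated row by row from the bottom, and from left to right in each row. At a vertex in row $u$ let (left, below) be the pair of occupancies of the incoming horizontal and vertical edges; the pair (right, above) of occupancies of the outgoing horizontal and vertical edges is chosen as follows, all random choices at different vertices being independent. If the two incoming bits agree, then (right, above) = (left, below). If they differ, then with probability $p_u$ the bits stay in place, (right, above) = (left, below), and with probability $1-p_u$ they are interchanged, (right, above) = (below, left). Almost surely exactly $m$ vertical edges leaving the top row $m$ are occupied; let $i_1<\cdots<i_m$ be their columns (the top exit positions). The random partition $\Lambda$ is defined by $i_a=\Lambda_{m+1-a}+a$ for $1\le a\le m$. *)

theory Defs
  imports "HOL-Probability.Probability" "HOL-Combinatorics.Permutations"
begin

text \<open>Partitions are lists of positive parts in weakly decreasing order, so that the length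
  \<open>\<ell>(\<lambda>)\<close> is the length of the list; \<open>part l j\<close> is the part \<open>\<lambda>\<^sub>j\<close> (indexed from 1, padded by 0).\<close>

definition is_partition :: "nat list \<Rightarrow> bool" where
  "is_partition l \<longleftrightarrow> sorted_wrt (\<ge>) l \<and> (\<forall>k\<in>set l. 0 < k)"

definition part :: "nat list \<Rightarrow> nat \<Rightarrow> nat" where
  "part l j = (if 1 \<le> j \<and> j \<le> length l then l ! (j - 1) else 0)"

definition position :: "nat \<Rightarrow> nat list \<Rightarrow> nat \<Rightarrow> nat" where
  "position m l a = part l (m + 1 - a) + a"

text \<open>The symmetrised expression, with variables \<open>x 1, \<dots>, x m\<close>. Where two of the variables
  coincide it contains divisions by zero.\<close>

definition ssm_formula :: "nat \<Rightarrow> nat list \<Rightarrow> (nat \<Rightarrow> real) \<Rightarrow> real" where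
  "ssm_formula m l x =
     (\<Sum>w | w permutes {1..m}.
        (\<Prod>u=1..m. x (w u) ^ (position m l u - 1) / (1 + x (w u)) ^ position m l u) *
        (\<Prod>(u, v) \<in> {(u, v). 1 \<le> u \<and> u < v \<and> v \<le> m}.
            (1 + x (w v) - x (w u)) / (x (w v) - x (w u))))"

text \<open>The apparent poles on the diagonals are removable: the value at \<open>x\<close> is that of the continuous
  extension of the formula from the points with pairwise distinct coordinates (in the product
  topology on \<^typ>\<open>nat \<Rightarrow> real\<close>; coordinates outside \<open>{1..m}\<close> play no role).
  At points with pairwise distinct coordinates this is the formula itself, see \<open>ssm_eq_formula\<close>.\<close>

definition ssm :: "nat \<Rightarrow> nat list \<Rightarrow> (nat \<Rightarrow> real) \<Rightarrow> real" where
  "ssm m l x = Lim (at x within {y. inj_on y {1..m}}) (ssm_formula m l)"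

lemma ssm_eq_formula:
  assumes "inj_on x {1..m}" and "\<And>i. i \<in> {1..m} \<Longrightarrow> x i \<ge> 0"
  shows "ssm m l x = ssm_formula m l x"
proof -
  let ?F = "at x within {y. inj_on y {1..m}}"
  define y where "y n = x(Suc m := x (Suc m) + 1 / real (Suc n))" for n :: nat
  have "y \<longlonglongrightarrow> x"
  proof -
    have "(\<lambda>n. y n i) \<longlonglongrightarrow> x i" for i
      using tendsto_add[OF tendsto_const[of "x (Suc m)"] LIMSEQ_inverse_real_of_nat]
      by (cases "i = Suc m") (simp_all add: y_def field_simps)
    then show ?thesis
      using limitin_componentwise[of "\<lambda>_. euclidean" UNIV y x sequentially]
      by (simp add: euclidean_product_topology)
  qed
  moreover have "y n \<in> {y. inj_on y {1..m}}" "y n \<noteq> x" for n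
  proof -
    show "y n \<in> {y. inj_on y {1..m}}"
    proof -
      have "inj_on (y n) {1..m} \<longleftrightarrow> inj_on x {1..m}"
        by (rule inj_on_cong) (simp add: y_def)
      with assms(1) show ?thesis by simp
    qed
    show "y n \<noteq> x"
    proof
      assume "y n = x"
      then have "y n (Suc m) = x (Suc m)" by simp
      then show False by (simp add: y_def)
    qed
  qed
  ultimately have "filterlim y ?F sequentially"
    by (simp add: filterlim_at)
  then have nontriv: "?F \<noteq> bot"
    by (auto simp: filterlim_def bot_unique filtermap_bot_iff)
  have coord: "((\<lambda>y. y i) \<longlongrightarrow> x i) ?F" for i
    using continuous_on_product_coordinates[of i]
    by (auto simp: continuous_on_def intro: tendsto_within_subset)
  have "(ssm_formula m l \<longlongrightarrow> ssm_formula m l x) ?F"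
    unfolding ssm_formula_def
  proof (intro tendsto_sum tendsto_mult tendsto_prod)
    fix w u assume "w \<in> {w. w permutes {1..m}}" "u \<in> {1..m}"
    then have "w u \<in> {1..m}"
      using permutes_in_image[of w "{1..m}" u] by simp
    then have "x (w u) \<ge> 0"
      by (rule assms(2))
    then show "((\<lambda>y. y (w u) ^ (position m l u - 1) / (1 + y (w u)) ^ position m l u) \<longlongrightarrow>
        x (w u) ^ (position m l u - 1) / (1 + x (w u)) ^ position m l u) ?F"
      by (intro tendsto_intros coord) auto
  next
    fix w uv assume w: "w \<in> {w. w permutes {1..m}}"
      and "uv \<in> {(u, v). 1 \<le> u \<and> u < v \<and> v \<le> m}"
    then obtain u v where uv: "uv = (u, v)" "1 \<le> u" "u < v" "v \<le> m" by auto
    have wp: "w permutes {1..m}" using w by simp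
    have wu: "w u \<in> {1..m}" "w v \<in> {1..m}"
      using uv by (simp_all only: permutes_in_image[OF wp]) auto
    have "w u \<noteq> w v"
      using uv(3) permutes_inj[OF wp] by (simp add: inj_eq)
    with wu have "x (w u) \<noteq> x (w v)"
      using inj_on_eq_iff[OF assms(1)] by metis
    then have "x (w v) - x (w u) \<noteq> 0"
      by simp
    then show "((\<lambda>y. case uv of (u, v) \<Rightarrow> (1 + y (w v) - y (w u)) / (y (w v) - y (w u))) \<longlongrightarrow>
        (case uv of (u, v) \<Rightarrow> (1 + x (w v) - x (w u)) / (x (w v) - x (w u)))) ?F"
      unfolding uv(1) prod.case by (intro tendsto_intros coord)
  qed
  with nontriv show ?thesis
    unfolding ssm_def by (rule tendsto_Lim)
qed

text \<open>\<open>vertex b (left, below) = (right, above)\<close>, where the coin \<open>b\<close> says whether two differing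
  bits stay in place.\<close>

fun vertex :: "bool \<Rightarrow> bool \<times> bool \<Rightarrow> bool \<times> bool" where
  "vertex b (left, below) = (if left = below \<or> b then (left, below) else (below, left))"

text \<open>A single row with coins \<open>k\<close> and occupied incoming vertical edges \<open>d\<close> (both indexed by the
  columns \<open>1, 2, \<dots>\<close>): \<open>horizontal k d c\<close> is the horizontal edge to the right of column \<open>c\<close>,
  where \<open>c = 0\<close> gives the edge entering the row from the left.\<close>

primrec horizontal :: "(nat \<Rightarrow> bool) \<Rightarrow> (nat \<Rightarrow> bool) \<Rightarrow> nat \<Rightarrow> bool" where
  "horizontal k d 0 = True"
| "horizontal k d (Suc c) = fst (vertex (k (Suc c)) (horizontal k d c, d (Suc c)))"

text \<open>\<open>vertical \<omega> u c\<close> is the vertical edge in column \<open>c \<ge> 1\<close> that leaves row \<open>u\<close> upwards;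
  \<open>u = 0\<close> gives the edges entering row 1 from below.\<close>

primrec vertical :: "(nat \<times> nat \<Rightarrow> bool) \<Rightarrow> nat \<Rightarrow> nat \<Rightarrow> bool" where
  "vertical \<omega> 0 = (\<lambda>c. False)"
| "vertical \<omega> (Suc u) =
     (\<lambda>c. snd (vertex (\<omega> (Suc u, c))
        (horizontal (\<lambda>c'. \<omega> (Suc u, c')) (vertical \<omega> u) (c - 1), vertical \<omega> u c)))"

definition six_vertex :: "nat \<Rightarrow> (nat \<Rightarrow> real) \<Rightarrow> (nat \<times> nat \<Rightarrow> bool) measure" where
  "six_vertex m p = PiM ({1..m} \<times> {1..}) (\<lambda>(u, c). measure_pmf (bernoulli_pmf (p u)))"

definition exits :: "nat \<Rightarrow> (nat \<times> nat \<Rightarrow> bool) \<Rightarrow> nat set" where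
  "exits m \<omega> = {c. 1 \<le> c \<and> vertical \<omega> m c}"

text \<open>The random partition is only defined on the almost sure event that there are exactly \<open>m\<close>
  exits; off this event it is \<^const>\<open>None\<close>.\<close>

definition exit_partition :: "nat \<Rightarrow> (nat \<times> nat \<Rightarrow> bool) \<Rightarrow> nat list option" where
  "exit_partition m \<omega> =
     (if finite (exits m \<omega>) \<and> card (exits m \<omega>) = m
      then Some (THE l. is_partition l \<and> length l \<le> m \<and>
        (\<forall>a\<in>{1..m}. sorted_list_of_set (exits m \<omega>) ! (a - 1) = part l (m + 1 - a) + a))
      else None)"

lemma part_eqI:
  assumes "is_partition l" "is_partition l'" "length l \<le> m" "length l' \<le> m"
    and "\<And>j. j \<in> {1..m} \<Longrightarrow> part l j = part l' j"
  shows "l = l'"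
proof -
  have le: "length k \<le> length k'"
    if "is_partition k" "length k \<le> m" "\<And>j. j \<in> {1..m} \<Longrightarrow> part k j = part k' j"
    for k k' :: "nat list"
  proof (rule ccontr)
    assume "\<not> length k \<le> length k'"
    then have "length k \<ge> 1" "part k' (length k) = 0"
      by (auto simp: part_def)
    moreover from this that(2) have "part k (length k) = part k' (length k)"
      by (intro that(3)) auto
    ultimately have "k ! (length k - 1) = 0"
      by (simp add: part_def)
    with that(1) \<open>length k \<ge> 1\<close> show False
      unfolding is_partition_def by (metis One_nat_def diff_less less_le_trans nth_mem
          less_numeral_extra(1) less_irrefl)
  qed
  have len: "length l = length l'"
    using le[of l l'] le[of l' l] assms by (metis le_antisym)
  show ?thesis
  proof (rule nth_equalityI[OF len])
    fix i assume i: "i < length l"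
    with assms(3) have "part l (Suc i) = part l' (Suc i)"
      by (intro assms(5)) auto
    with i len show "l ! i = l' ! i"
      by (simp add: part_def)
  qed
qed

lemma part_antimono:
  assumes "is_partition l" "1 \<le> j" "j \<le> k"
  shows "part l k \<le> part l j"
proof (cases "k \<le> length l \<and> j < k")
  case True
  with assms show ?thesis
    by (auto simp: part_def is_partition_def sorted_wrt_iff_nth_less)
next
  case False
  with assms show ?thesis
    by (auto simp: part_def)
qed

lemma ex_partition_of_set:
  assumes "finite S" "card S = m" "\<And>c. c \<in> S \<Longrightarrow> 1 \<le> c"
  shows "\<exists>l. is_partition l \<and> length l \<le> m \<and>
    (\<forall>a\<in>{1..m}. sorted_list_of_set S ! (a - 1) = part l (m + 1 - a) + a)"
proof -
  define s where "s = sorted_list_of_set S"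
  have len: "length s = m" and st: "sorted_wrt (<) s" and pos: "\<And>c. c \<in> set s \<Longrightarrow> 1 \<le> c"
    using assms by (simp_all add: s_def)
  have step: "s ! i - Suc i \<le> s ! j - Suc j \<and> Suc i \<le> s ! i" if "i \<le> j" "j < m" for i j
  proof -
    have 1: "Suc i \<le> s ! i" if "i < m" for i
      using that
    proof (induction i)
      case 0
      then show ?case using pos[of "s ! 0"] len by auto
    next
      case (Suc i)
      then show ?case
        using sorted_wrt_nth_less[OF st, of i "Suc i"] len by auto
    qed
    have "s ! i + (j - i) \<le> s ! j"
      using that
    proof (induction j rule: dec_induct)
      case base
      then show ?case by simp
    next
      case (step j)
      then show ?case
        using sorted_wrt_nth_less[OF st, of j "Suc j"] len by auto
    qed
    with that 1[of i] show ?thesis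
      by auto
  qed
  define g where "g j = s ! (m - j) - (m + 1 - j)" for j
  define r where "r = card {j \<in> {1..m}. 0 < g j}"
  have g_anti: "g k \<le> g j" if "1 \<le> j" "j \<le> k" "k \<le> m" for j k
    using step[of "m - k" "m - j"] that by (simp add: g_def Suc_diff_le)
  have dc: "{j \<in> {1..m}. 0 < g j} = {1..r}"
  proof (cases "{j \<in> {1..m}. 0 < g j} = {}")
    case True
    then show ?thesis by (simp add: r_def)
  next
    case False
    define M where "M = Max {j \<in> {1..m}. 0 < g j}"
    have M: "M \<in> {j \<in> {1..m}. 0 < g j}" "\<And>j. j \<in> {j \<in> {1..m}. 0 < g j} \<Longrightarrow> j \<le> M"
      unfolding M_def using False by (intro Max_in Max_ge; simp)+
    have "{j \<in> {1..m}. 0 < g j} = {1..M}"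
      using M g_anti[of _ M] by (fastforce intro: less_le_trans)
    then show ?thesis
      by (simp add: r_def)
  qed
  have rm: "r \<le> m"
    unfolding r_def by (rule order.trans[OF card_mono[of "{1..m}"]]) auto
  define l where "l = map g [1..<Suc r]"
  have len_l: "length l = r"
    by (simp add: l_def)
  have nth_l: "l ! i = g (Suc i)" if "i < r" for i
    using that by (simp add: l_def del: upt_Suc)
  have "is_partition l"
    unfolding is_partition_def
  proof
    show "sorted_wrt (\<ge>) l"
      using rm by (auto simp: sorted_wrt_iff_nth_less len_l nth_l intro!: g_anti)
    show "\<forall>k\<in>set l. 0 < k"
    proof
      fix k assume "k \<in> set l"
      then obtain j where "j \<in> {1..r}" "k = g j"
        by (auto simp: l_def less_Suc_eq_le simp del: upt_Suc)
      with dc show "0 < k" by blast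
    qed
  qed
  moreover have "s ! (a - 1) = part l (m + 1 - a) + a" if "a \<in> {1..m}" for a
  proof -
    have "part l (m + 1 - a) = g (m + 1 - a)"
    proof (cases "m + 1 - a \<le> r")
      case True
      with that show ?thesis by (simp add: part_def len_l nth_l Suc_diff_le)
    next
      case False
      then have "m + 1 - a \<notin> {j \<in> {1..m}. 0 < g j}" unfolding dc by simp
      with that have "g (m + 1 - a) = 0" by auto
      with False show ?thesis by (simp add: part_def len_l)
    qed
    moreover have "a \<le> s ! (a - 1)"
      using step[of "a - 1" "a - 1"] that by auto
    moreover have "g (m + 1 - a) = s ! (a - 1) - a"
    proof -
      have "m - (m + 1 - a) = a - 1" "m + 1 - (m + 1 - a) = a" using that by auto
      then show ?thesis by (simp add: g_def)
    qed
    ultimately show ?thesis by simp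
  qed
  ultimately show ?thesis
    using rm by (auto simp: s_def len_l)
qed

lemma exit_partition_eq_Some_iff:
  assumes "is_partition l" "length l \<le> m"
  shows "exit_partition m \<omega> = Some l \<longleftrightarrow> exits m \<omega> = position m l ` {1..m}"
proof -
  define P where "P S l \<longleftrightarrow> is_partition l \<and> length l \<le> m \<and>
    (\<forall>a\<in>{1..m}. sorted_list_of_set S ! (a - 1) = part l (m + 1 - a) + a)" for S l
  have uniq: "l1 = l2" if "P S l1" "P S l2" for S l1 l2
  proof (rule part_eqI[of _ _ m])
    fix j assume "j \<in> {1..m}"
    then have "m + 1 - j \<in> {1..m}" "m + 1 - (m + 1 - j) = j" by auto
    with that show "part l1 j = part l2 j"
      unfolding P_def by (metis add_right_cancel)
  qed (use that in \<open>auto simp: P_def\<close>)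
  have mono: "position m l a < position m l b" if "1 \<le> a" "a < b" "b \<le> m" for a b
  proof -
    have "part l (m + 1 - a) \<le> part l (m + 1 - b)"
      using that by (intro part_antimono[OF assms(1)]) auto
    with that show ?thesis by (simp add: position_def)
  qed
  have P_iff: "P S l \<longleftrightarrow> S = position m l ` {1..m}" if S: "finite S" "card S = m" for S
  proof -
    define t where "t = map (position m l) [1..<Suc m]"
    have nth_t: "t ! i = position m l (Suc i)" if "i < m" for i
      using that by (simp add: t_def del: upt_Suc)
    have len_t: "length t = m" by (simp add: t_def)
    have t: "sorted_wrt (<) t" "set t = position m l ` {1..m}"
      by (auto simp: sorted_wrt_iff_nth_less len_t nth_t intro!: mono)
         (auto simp: t_def simp del: upt_Suc)
    have "P S l \<longleftrightarrow> (\<forall>i<m. sorted_list_of_set S ! i = t ! i)"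
    proof -
      have "P S l \<longleftrightarrow> (\<forall>a\<in>{1..m}. sorted_list_of_set S ! (a - 1) = position m l a)"
        using assms by (simp add: P_def position_def)
      also have "\<dots> \<longleftrightarrow> (\<forall>i<m. sorted_list_of_set S ! i = position m l (Suc i))"
      proof safe
        fix i assume "\<forall>a\<in>{1..m}. sorted_list_of_set S ! (a - 1) = position m l a" "i < m"
        then show "sorted_list_of_set S ! i = position m l (Suc i)"
          by (auto dest: bspec[of _ _ "Suc i"])
      next
        fix a assume "\<forall>i<m. sorted_list_of_set S ! i = position m l (Suc i)" "a \<in> {1..m}"
        then show "sorted_list_of_set S ! (a - 1) = position m l a"
          by (cases a) auto
      qed
      finally show ?thesis by (simp add: nth_t)
    qed
    also have "\<dots> \<longleftrightarrow> sorted_list_of_set S = t"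
      using S by (auto simp: list_eq_iff_nth_eq len_t)
    also have "\<dots> \<longleftrightarrow> S = set t"
      using S t(1) by (metis sorted_list_of_set.set_sorted_key_list_of_set
          sorted_list_of_set.idem_if_sorted_distinct strict_sorted_iff)
    finally show ?thesis by (simp add: t(2))
  qed
  have card_pos: "card (position m l ` {1..m}) = m"
  proof -
    have "inj_on (position m l) {1..m}"
      by (rule linorder_inj_onI) (use mono in fastforce)+
    then show ?thesis by (simp add: card_image)
  qed
  show ?thesis
  proof (cases "finite (exits m \<omega>) \<and> card (exits m \<omega>) = m")
    case True
    then have ex: "\<exists>l. P (exits m \<omega>) l"
      using ex_partition_of_set[of "exits m \<omega>" m] by (auto simp: P_def exits_def)
    have "exit_partition m \<omega> = Some (THE l. P (exits m \<omega>) l)"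
      using True by (simp add: exit_partition_def P_def)
    moreover have "(THE l. P (exits m \<omega>) l) = l \<longleftrightarrow> P (exits m \<omega>) l"
      using ex uniq by (metis the_equality)
    ultimately show ?thesis
      using P_iff True by simp
  next
    case False
    then have "exit_partition m \<omega> = None" by (simp add: exit_partition_def)
    moreover have "exits m \<omega> \<noteq> position m l ` {1..m}"
      using False card_pos by auto
    ultimately show ?thesis by simp
  qed
qed

end

theory Submission
  imports Defs "HOL-Combinatorics.Multiset_Permutations"
begin

text \<open>Every path that is still in the strip after some columns sits on one of the \<open>m\<close> horizontal edges to
the right of the last column, so the model can be read column by column: a column maps the
\<open>m\<close> occupancies to its left to those on its right and emits one bit at the top. A prescribed set of \<open>m\<close>
exits thus becomes a finite list of emitted bits after which no path is left, and its
probability is the polynomial expression \<open>exit_weight\<close> in the probabilities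
\<open>x\<^sub>u / (1 + x\<^sub>u)\<close> and \<open>1 / (1 + x\<^sub>u)\<close> (\<open>prob_exits_match\<close>).

It remains to identify this expression, by induction on the columns, with the
symmetrisation that defines \<open>ssm\<close> (\<open>exit_weight_eq_set_weight\<close>). Initially all rows carry a path. If
the first column is not an exit, all paths go straight, with weight \<open>\<Prod> x\<^sub>u / (1 + x\<^sub>u)\<close>; this is the
effect of shifting all exits by one column. If it is an exit, exactly one path leaves, and
one has to sum, over the row that it leaves, the weights of systems with one idle row. An idle row at
the bottom can simply be omitted. The Yang-Baxter equation (\<open>yang_baxter_exit_weight\<close>) expresses
the weight with an idle row through weights in which the row below it is idle, and so reduces an
arbitrary idle row to systems with one row less (\<open>exit_weight_one_idle\<close>). The
resulting double sum telescopes (\<open>column_sum_full_exit\<close>) to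

\<open>\<Sum>a. 1 / (1 + a) * (\<Prod>b \<noteq> a. b / (1 + b) * (1 + b - a) / (b - a)) * (weight without the parameter a)\<close>,

which is the recursion obtained from the symmetrisation by fixing the variable attached to the first exit.

This needs distinct parameters. Since \<open>exit_weight\<close> is continuous, and the identity is valid
near every admissible point, including points with small negative coordinates, the
limit that defines \<open>ssm\<close> at coinciding parameters is the exit weight as well (\<open>ssm_eq_exit_weight\<close>).\<close>

section \<open>Transfer weights of the columns\<close>

text \<open>The expectation of \<open>f (outgoing horizontal edges) (edge leaving at the top)\<close> over the coins of one
column, whose rows are listed from bottom to top; \<open>v\<close> is the vertical edge that enters from below.
A row with parameter \<open>x\<close> keeps two differing bits in place with weight \<open>x / (1 + x)\<close>. The
parameters are arbitrary reals, so this is a probability only if they are nonnegative; the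
generality is needed because \<^const>\<open>ssm\<close> is a limit over points that may have negative coordinates.\<close>

fun column_sum :: "real list \<Rightarrow> bool list \<Rightarrow> bool \<Rightarrow> (bool list \<Rightarrow> bool \<Rightarrow> real) \<Rightarrow> real" where
  "column_sum (x # xs) (h # hs) v f =
     (if h = v then column_sum xs hs v (\<lambda>hs'. f (h # hs'))
      else x / (1 + x) * column_sum xs hs v (\<lambda>hs'. f (h # hs')) +
           1 / (1 + x) * column_sum xs hs h (\<lambda>hs'. f (v # hs')))"
| "column_sum _ _ v f = f [] v"

text \<open>The weight of the event that the next columns emit exactly the bits \<open>es\<close> at the top and that no
path is left after them.\<close>

fun exit_weight :: "real list \<Rightarrow> bool list \<Rightarrow> bool list \<Rightarrow> real" where
  "exit_weight xs hs [] = (if True \<in> set hs then 0 else 1)"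
| "exit_weight xs hs (e # es) =
     column_sum xs hs False (\<lambda>hs' v. if v = e then exit_weight xs hs' es else 0)"

lemma column_sum_lincomb:
  "column_sum xs hs v (\<lambda>hs' v'. r * f hs' v' + s * g hs' v') =
     r * column_sum xs hs v f + s * column_sum xs hs v g"
proof (induction xs arbitrary: hs v f g)
  case (Cons x xs)
  then show ?case
    by (cases hs) (simp_all add: algebra_simps add_divide_distrib)
qed simp

lemma column_sum_cong:
  assumes "\<And>hs' v'. length hs' = min (length xs) (length hs) \<Longrightarrow> f hs' v' = g hs' v'"
  shows "column_sum xs hs v f = column_sum xs hs v g"
  using assms
proof (induction xs arbitrary: hs v f g)
  case (Cons x xs)
  show ?case
  proof (cases hs)
    case Nil
    with Cons.prems show ?thesis by simp
  next
    case (Cons h hs')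
    have "column_sum xs hs' v' (\<lambda>hs'. f (h' # hs')) = column_sum xs hs' v' (\<lambda>hs'. g (h' # hs'))"
      for h' v'
      by (rule Cons.IH) (use Cons.prems local.Cons in auto)
    then show ?thesis using Cons by simp
  qed
qed simp

section \<open>The Yang-Baxter equation\<close>

lemma mult_lincomb_eq:
  fixes r :: real
  assumes "r * y\<^sub>1 = s * z\<^sub>1 + t\<^sub>1" "r * y\<^sub>2 = s * z\<^sub>2 + t\<^sub>2"
  shows "r * (p * y\<^sub>1 + q * y\<^sub>2) = s * (p * z\<^sub>1 + q * z\<^sub>2) + (p * t\<^sub>1 + q * t\<^sub>2)"
proof -
  have "r * (p * y\<^sub>1 + q * y\<^sub>2) = p * (r * y\<^sub>1) + q * (r * y\<^sub>2)" by (simp add: algebra_simps)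
  then show ?thesis by (simp add: assms algebra_simps)
qed

text \<open>The hypothesis says that \<open>f'\<close> is obtained from \<open>f\<close> by an additional vertex at which the two
adjacent rows with parameters \<open>a\<close> and \<open>b\<close> cross, with swapping weight
\<open>(a - b) / (1 + a - b)\<close>; denominators are cleared since \<open>1 + a - b\<close> may vanish. The conclusion
says that the crossing can be pulled through a column. Rows below the pair and the rows above it
only enter through linearity, so everything reduces to the eight configurations of two vertices.\<close>

lemma yang_baxter_column:
  fixes a b :: real
  assumes "1 + a \<noteq> 0" "1 + b \<noteq> 0" "length hs\<^sub>1 = length us"
    and "\<And>H\<^sub>1 k\<^sub>1 k\<^sub>2 H\<^sub>2 v. length H\<^sub>1 = length us \<Longrightarrow>
      (1 + a - b) * f' (H\<^sub>1 @ k\<^sub>1 # k\<^sub>2 # H\<^sub>2) v =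
      (a - b) * f (H\<^sub>1 @ k\<^sub>2 # k\<^sub>1 # H\<^sub>2) v + f (H\<^sub>1 @ k\<^sub>1 # k\<^sub>2 # H\<^sub>2) v"
  shows "(1 + a - b) * column_sum (us @ b # a # vs) (hs\<^sub>1 @ h\<^sub>1 # h\<^sub>2 # hs\<^sub>2) v f' =
    (a - b) * column_sum (us @ a # b # vs) (hs\<^sub>1 @ h\<^sub>2 # h\<^sub>1 # hs\<^sub>2) v f +
    column_sum (us @ a # b # vs) (hs\<^sub>1 @ h\<^sub>1 # h\<^sub>2 # hs\<^sub>2) v f"
  using assms(3,4)
proof (induction us arbitrary: hs\<^sub>1 v f f')
  case Nil
  have f: "(1 + a - b) * column_sum vs hs\<^sub>2 v' (\<lambda>hs'. f' (k\<^sub>1 # k\<^sub>2 # hs')) =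
      (a - b) * column_sum vs hs\<^sub>2 v' (\<lambda>hs'. f (k\<^sub>2 # k\<^sub>1 # hs')) +
      column_sum vs hs\<^sub>2 v' (\<lambda>hs'. f (k\<^sub>1 # k\<^sub>2 # hs'))" for k\<^sub>1 k\<^sub>2 v'
  proof -
    have "(1 + a - b) * column_sum vs hs\<^sub>2 v' (\<lambda>hs'. f' (k\<^sub>1 # k\<^sub>2 # hs')) =
       column_sum vs hs\<^sub>2 v' (\<lambda>hs' v. (1 + a - b) * f' (k\<^sub>1 # k\<^sub>2 # hs') v + 0 * f' [] v)"
      by (subst column_sum_lincomb) simp
    also have "\<dots> = column_sum vs hs\<^sub>2 v' (\<lambda>hs' v. (a - b) * f (k\<^sub>2 # k\<^sub>1 # hs') v + 1 * f (k\<^sub>1 # k\<^sub>2 # hs') v)"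
      using Nil(2)[of "[]"] by simp
    also have "\<dots> = (a - b) * column_sum vs hs\<^sub>2 v' (\<lambda>hs'. f (k\<^sub>2 # k\<^sub>1 # hs')) +
      column_sum vs hs\<^sub>2 v' (\<lambda>hs'. f (k\<^sub>1 # k\<^sub>2 # hs'))"
      by (subst column_sum_lincomb) simp
    finally show ?thesis .
  qed
  define C where "C k\<^sub>1 k\<^sub>2 v' = column_sum vs hs\<^sub>2 v' (\<lambda>hs'. f (k\<^sub>1 # k\<^sub>2 # hs'))" for k\<^sub>1 k\<^sub>2 v'
  define C' where "C' k\<^sub>1 k\<^sub>2 v' = column_sum vs hs\<^sub>2 v' (\<lambda>hs'. f' (k\<^sub>1 # k\<^sub>2 # hs'))" for k\<^sub>1 k\<^sub>2 v'
  have CC: "(1 + a - b) * C' k\<^sub>1 k\<^sub>2 v' = (a - b) * C k\<^sub>2 k\<^sub>1 v' + C k\<^sub>1 k\<^sub>2 v'" for k\<^sub>1 k\<^sub>2 v'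
    using f by (simp add: C_def C'_def)
  note C = C_def[symmetric] C'_def[symmetric]
  have dist: "(1 + a - b) * (y + z) = (1 + a - b) * y + (1 + a - b) * z"
     "(1 + a - b) * (r * y) = r * ((1 + a - b) * y)" for r y z
    by (simp_all add: algebra_simps)
  have [simp]: "hs\<^sub>1 = []" using Nil by simp
  \<comment> \<open>After \<open>dist\<close> has moved the factor \<open>1 + a - b\<close> to the innermost terms, \<open>CC\<close> eliminates \<open>C'\<close>, and
    what remains is a rational identity in \<open>a\<close> and \<open>b\<close> for every value of \<open>C\<close>.\<close>
  show ?case
    apply (cases h\<^sub>1; cases h\<^sub>2; cases v)
    apply (simp_all only: \<open>hs\<^sub>1 = []\<close> append_Nil column_sum.simps C if_True if_False simp_thms dist CC)
    using assms(1,2)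
    apply (simp_all add: divide_simps)
    apply (simp_all add: algebra_simps)
    done
next
  case (Cons u us)
  then obtain h hs where hs1: "hs\<^sub>1 = h # hs" "length hs = length us"
    by (cases hs\<^sub>1) auto
  have IH: "(1 + a - b) * column_sum (us @ b # a # vs) (hs @ h\<^sub>1 # h\<^sub>2 # hs\<^sub>2) v (\<lambda>hs'. f' (k # hs')) =
    (a - b) * column_sum (us @ a # b # vs) (hs @ h\<^sub>2 # h\<^sub>1 # hs\<^sub>2) v (\<lambda>hs'. f (k # hs')) +
    column_sum (us @ a # b # vs) (hs @ h\<^sub>1 # h\<^sub>2 # hs\<^sub>2) v (\<lambda>hs'. f (k # hs'))" for k v
    by (rule Cons.IH) (use Cons.prems(2)[of "k # _"] hs1 in auto)
  show ?case
    using IH unfolding hs1 by (auto intro!: mult_lincomb_eq simp del: times_divide_eq_left mult_1)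
qed

text \<open>Pulling the crossing through all columns, it arrives where every horizontal edge is empty and
does nothing. Hence exchanging the parameters of two neighbouring rows amounts to mixing the two
orders of their incoming edges.\<close>

lemma yang_baxter_exit_weight:
  fixes a b :: real
  assumes "1 + a \<noteq> 0" "1 + b \<noteq> 0" "length hs\<^sub>1 = length us"
  shows "(1 + a - b) * exit_weight (us @ b # a # vs) (hs\<^sub>1 @ h\<^sub>1 # h\<^sub>2 # hs\<^sub>2) es =
    (a - b) * exit_weight (us @ a # b # vs) (hs\<^sub>1 @ h\<^sub>2 # h\<^sub>1 # hs\<^sub>2) es +
    exit_weight (us @ a # b # vs) (hs\<^sub>1 @ h\<^sub>1 # h\<^sub>2 # hs\<^sub>2) es"
  using assms(3)
proof (induction es arbitrary: hs\<^sub>1 h\<^sub>1 h\<^sub>2 hs\<^sub>2)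
  case Nil
  then show ?case by auto
next
  case (Cons e es)
  show ?case
    unfolding exit_weight.simps
    by (rule yang_baxter_column[OF assms(1,2)]) (use Cons in auto)
qed

section \<open>The first column when every row carries a path\<close>

text \<open>No path enters the bottom row from the left or from below, so its edges stay empty forever.\<close>

lemma exit_weight_idle_bottom: "exit_weight (x # xs) (False # hs) es = exit_weight xs hs es"
proof (induction es arbitrary: hs)
  case (Cons e es)
  then show ?case by (simp cong: if_cong)
qed simp

text \<open>The symmetrisation that defines \<^const>\<open>ssm_formula\<close>, organised by columns: when the first column
is an exit, one sums over the variable \<open>a\<close> that the permutation assigns to the first exit, and
the factors \<open>b / (1 + b)\<close> shift all later exits by one column. As a function of a set of
parameters it is symmetric by construction.\<close>

fun set_weight :: "bool list \<Rightarrow> real set \<Rightarrow> real" where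
  "set_weight [] X = (if X = {} then 1 else 0)"
| "set_weight (False # es) X = (\<Prod>a\<in>X. a / (1 + a)) * set_weight es X"
| "set_weight (True # es) X =
     (\<Sum>a\<in>X. 1 / (1 + a) * (\<Prod>b\<in>X - {a}. b / (1 + b) * ((1 + b - a) / (b - a))) *
        set_weight es (X - {a}))"

text \<open>An idle row at the bottom can be deleted. The relation \<open>yang_baxter_exit_weight\<close> moves an idle row
with parameter \<open>a\<close> upwards past the rows \<open>us\<close>, and each step adds one more row that may turn out to
be the deleted one. The weights of the smaller systems are symmetric functions of their
parameters by \<open>full\<close>, so all terms in which the row \<open>j\<close> is deleted can be collected; the
coefficients multiply up because of the identity
\<open>c(u,a) / (a - j) - 1 / ((u - j) (u - a)) = c(u,j) / (a - j)\<close>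
for \<open>c(i,j) = (1 + i - j) / (i - j)\<close>.\<close>

lemma exit_weight_one_idle:
  fixes us vs :: "real list"
  assumes full: "\<And>xs. distinct xs \<Longrightarrow> -1 \<notin> set xs \<Longrightarrow>
      exit_weight xs (replicate (length xs) True) es = set_weight es (set xs)"
    and "distinct (us @ a # vs)" "-1 \<notin> set (us @ a # vs)"
  shows "exit_weight (us @ a # vs) (replicate (length us) True @ False # replicate (length vs) True) es =
    (\<Prod>i\<in>set us. (1 + i - a) / (i - a)) * set_weight es (set us \<union> set vs) +
    (\<Sum>j\<in>set us. (\<Prod>i\<in>set us - {j}. (1 + i - j) / (i - j)) / (a - j) *
        set_weight es (insert a (set us - {j} \<union> set vs)))"
  using assms(2,3)
proof (induction us arbitrary: a vs rule: rev_induct)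
  case Nil
  then show ?case by (simp add: exit_weight_idle_bottom full)
next
  case (snoc u us)
  define c where "c i j = (1 + i - j) / (i - j)" for i j :: real
  define F where "F = set_weight es"
  define U V where "U = set us" and "V = set vs"
  have ne: "u \<noteq> a" "u \<notin> U" "a \<notin> U" "u \<notin> V" "a \<notin> V" "U \<inter> V = {}" "1 + u \<noteq> 0" "1 + a \<noteq> 0"
    using snoc.prems by (auto simp: U_def V_def)
  have fin [simp]: "finite U" by (simp add: U_def)
  have rep: "replicate (length (us @ [u])) True = replicate (length us) True @ [True]"
    by (simp add: replicate_append_same)
  have "(1 + u - a) * exit_weight (us @ a # u # vs) (replicate (length us) True @ False # True # replicate (length vs) True) es
     = (u - a) * exit_weight (us @ u # a # vs) (replicate (length us) True @ True # False # replicate (length vs) True) es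
     + exit_weight (us @ u # a # vs) (replicate (length us) True @ False # True # replicate (length vs) True) es"
    by (rule yang_baxter_exit_weight) (use ne in auto)
  moreover have "exit_weight (us @ a # u # vs) (replicate (length us) True @ False # True # replicate (length vs) True) es
     = (\<Prod>i\<in>U. c i a) * F (insert u (U \<union> V)) +
       (\<Sum>j\<in>U. (\<Prod>i\<in>U-{j}. c i j) / (a - j) * F (insert a (insert u (U - {j} \<union> V))))"
    using snoc.IH[of a "u # vs"] snoc.prems by (simp add: U_def V_def c_def F_def)
  moreover have "exit_weight (us @ u # a # vs) (replicate (length us) True @ False # True # replicate (length vs) True) es
     = (\<Prod>i\<in>U. c i u) * F (insert a (U \<union> V)) +
       (\<Sum>j\<in>U. (\<Prod>i\<in>U-{j}. c i j) / (u - j) * F (insert a (insert u (U - {j} \<union> V))))"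
    using snoc.IH[of u "a # vs"] snoc.prems by (simp add: U_def V_def c_def F_def insert_commute)
  ultimately have "exit_weight ((us @ [u]) @ a # vs) (replicate (length (us @ [u])) True @ False # replicate (length vs) True) es =
     ((1 + u - a) * ((\<Prod>i\<in>U. c i a) * F (insert u (U \<union> V)) +
       (\<Sum>j\<in>U. (\<Prod>i\<in>U-{j}. c i j) / (a - j) * F (insert a (insert u (U - {j} \<union> V)))))
    - ((\<Prod>i\<in>U. c i u) * F (insert a (U \<union> V)) +
       (\<Sum>j\<in>U. (\<Prod>i\<in>U-{j}. c i j) / (u - j) * F (insert a (insert u (U - {j} \<union> V)))))) / (u - a)"
    unfolding rep using ne(1) by (simp add: field_simps)
  also have "\<dots> = c u a * (\<Prod>i\<in>U. c i a) * F (insert u (U \<union> V)) + (\<Prod>i\<in>U. c i u) / (a - u) * F (insert a (U \<union> V)) +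
     (\<Sum>j\<in>U. (\<Prod>i\<in>U-{j}. c i j) * F (insert a (insert u (U - {j} \<union> V))) *
        ((1 + u - a) / ((a - j) * (u - a)) - 1 / ((u - j) * (u - a))))"
  proof -
    have "(\<Sum>j\<in>U. (\<Prod>i\<in>U-{j}. c i j) * F (insert a (insert u (U - {j} \<union> V))) *
        ((1 + u - a) / ((a - j) * (u - a)) - 1 / ((u - j) * (u - a)))) =
      ((1 + u - a) * (\<Sum>j\<in>U. (\<Prod>i\<in>U-{j}. c i j) / (a - j) * F (insert a (insert u (U - {j} \<union> V)))) -
       (\<Sum>j\<in>U. (\<Prod>i\<in>U-{j}. c i j) / (u - j) * F (insert a (insert u (U - {j} \<union> V))))) / (u - a)"
      unfolding sum_distrib_left sum_subtractf[symmetric] sum_divide_distrib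
      by (rule sum.cong[OF refl], simp only: divide_inverse inverse_mult_distrib) (simp add: algebra_simps)
    moreover have "(\<Prod>i\<in>U. c i u) / (a - u) * F (insert a (U \<union> V)) = - ((\<Prod>i\<in>U. c i u) * F (insert a (U \<union> V))) / (u - a)"
      using ne(1) by (simp add: field_simps)
    ultimately show ?thesis
      unfolding c_def[of u a] by (simp only: divide_inverse) (simp add: algebra_simps)
  qed
  also have "(\<Sum>j\<in>U. (\<Prod>i\<in>U-{j}. c i j) * F (insert a (insert u (U - {j} \<union> V))) *
        ((1 + u - a) / ((a - j) * (u - a)) - 1 / ((u - j) * (u - a)))) =
     (\<Sum>j\<in>U. (\<Prod>i\<in>insert u U-{j}. c i j) / (a - j) * F (insert a (insert u U - {j} \<union> V)))"
  proof (rule sum.cong[OF refl])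
    fix j assume j: "j \<in> U"
    then have ne': "j \<noteq> u" "j \<noteq> a" using ne by auto
    have "(1 + u - a) / ((a - j) * (u - a)) - 1 / ((u - j) * (u - a)) = c u j / (a - j)"
      using ne' ne(1) by (simp add: c_def divide_simps) (simp add: algebra_simps)
    moreover have "insert u U - {j} = insert u (U - {j})" using ne' by auto
    ultimately show "(\<Prod>i\<in>U-{j}. c i j) * F (insert a (insert u (U - {j} \<union> V))) *
        ((1 + u - a) / ((a - j) * (u - a)) - 1 / ((u - j) * (u - a))) =
      (\<Prod>i\<in>insert u U-{j}. c i j) / (a - j) * F (insert a (insert u U - {j} \<union> V))"
      using ne(2) by simp
  qed
  also have "c u a * (\<Prod>i\<in>U. c i a) * F (insert u (U \<union> V)) + (\<Prod>i\<in>U. c i u) / (a - u) * F (insert a (U \<union> V)) +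
     (\<Sum>j\<in>U. (\<Prod>i\<in>insert u U-{j}. c i j) / (a - j) * F (insert a (insert u U - {j} \<union> V))) =
     (\<Prod>i\<in>insert u U. c i a) * F (insert u U \<union> V) +
     (\<Sum>j\<in>insert u U. (\<Prod>i\<in>insert u U-{j}. c i j) / (a - j) * F (insert a (insert u U - {j} \<union> V)))"
    using ne(2) by simp
  finally show ?case by (simp add: U_def V_def c_def F_def)
qed

text \<open>Once a path runs upwards in the column, it passes through every occupied row unchanged.\<close>

lemma column_sum_full_below:
  "length hs = length xs \<Longrightarrow> v \<Longrightarrow> \<forall>h\<in>set hs. h \<Longrightarrow> column_sum xs hs v f = f hs True"
proof (induction xs arbitrary: hs f)
  case (Cons x xs)
  then show ?case by (cases hs) auto
qed simp

text \<open>Suppose that every row carries a path and the first column is an exit. Then some path turns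
upwards, say in the row \<open>a\<close>; the paths below it went straight and those above it are unaffected, so
that the row \<open>a\<close> is idle from then on and \<open>exit_weight_one_idle\<close> applies. The sum over the row of
the turn telescopes: the part of it that belongs to rows in \<open>us\<close> is the same expression as in
\<^const>\<open>set_weight\<close>, but with the product and the sum restricted to \<open>us\<close>. Adding a row \<open>a\<close> to \<open>us\<close>
changes the term of \<open>j\<close> by the contribution of a turn in the row \<open>a\<close>, since
\<open>a / (1 + a) * c(a,j) = 1 + j / ((1 + a) (a - j))\<close>.\<close>

lemma column_sum_full_exit:
  fixes us vs :: "real list"
  assumes full: "\<And>xs. distinct xs \<Longrightarrow> -1 \<notin> set xs \<Longrightarrow>
      exit_weight xs (replicate (length xs) True) es = set_weight es (set xs)"
    and "distinct (us @ vs)" "-1 \<notin> set (us @ vs)"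
  shows "(\<Sum>j\<in>set us. 1 / (1 + j) * (\<Prod>i\<in>set us - {j}. i / (1 + i) * ((1 + i - j) / (i - j))) *
        set_weight es (set (us @ vs) - {j})) +
      (\<Prod>i\<in>set us. i / (1 + i)) *
      column_sum vs (replicate (length vs) True) False
        (\<lambda>hs' v. if v then exit_weight (us @ vs) (replicate (length us) True @ hs') es else 0) =
    set_weight (True # es) (set (us @ vs))"
  using assms(2,3)
proof (induction vs arbitrary: us)
  case Nil
  then show ?case by simp
next
  case (Cons a vs)
  define c where "c i j = (1 + i - j) / (i - j)" for i j :: real
  define F where "F = set_weight es"
  define U V where "U = set us" and "V = set vs"
  define X where "X = insert a (U \<union> V)"
  define P where "P = (\<Prod>i\<in>U. i / (1 + i))"
  define T where "T = column_sum vs (replicate (length vs) True) False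
        (\<lambda>hs' v. if v then exit_weight (us @ a # vs) (replicate (length us) True @ True # hs') es else 0)"
  have X: "set (us @ a # vs) = X" by (auto simp: X_def U_def V_def)
  have ne: "a \<notin> U" "a \<notin> V" "U \<inter> V = {}" "1 + a \<noteq> 0"
    using Cons.prems by (auto simp: U_def V_def)
  have fin [simp]: "finite U" by (simp add: U_def)
  have IH: "(\<Sum>j\<in>insert a U. 1 / (1 + j) * (\<Prod>i\<in>insert a U - {j}. i / (1 + i) * c i j) * F (X - {j})) +
      (\<Prod>i\<in>insert a U. i / (1 + i)) * T = set_weight (True # es) X"
    using Cons.IH[of "us @ [a]"] Cons.prems
    by (simp add: c_def U_def V_def X_def F_def T_def replicate_append_same replicate_app_Cons_same cong: if_cong)
  have idle: "exit_weight (us @ a # vs) (replicate (length us) True @ False # replicate (length vs) True) es =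
    (\<Prod>i\<in>U. c i a) * F (X - {a}) + (\<Sum>j\<in>U. (\<Prod>i\<in>U - {j}. c i j) / (a - j) * F (X - {j}))"
  proof -
    have "X - {a} = U \<union> V" using ne by (auto simp: X_def)
    moreover have "(\<Sum>j\<in>U. (\<Prod>i\<in>U - {j}. c i j) / (a - j) * F (X - {j})) =
       (\<Sum>j\<in>U. (\<Prod>i\<in>U - {j}. c i j) / (a - j) * F (insert a (U - {j} \<union> V)))"
    proof (rule sum.cong[OF refl])
      fix j assume "j \<in> U"
      then have "X - {j} = insert a (U - {j} \<union> V)" using ne by (auto simp: X_def)
      then show "(\<Prod>i\<in>U - {j}. c i j) / (a - j) * F (X - {j}) =
         (\<Prod>i\<in>U - {j}. c i j) / (a - j) * F (insert a (U - {j} \<union> V))" by simp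
    qed
    ultimately show ?thesis
      using exit_weight_one_idle[OF full Cons.prems] by (simp add: U_def V_def c_def F_def)
  qed
  define Q where "Q = 1 / (1 + a) * ((\<Prod>i\<in>U. c i a) * F (X - {a}) +
      (\<Sum>j\<in>U. (\<Prod>i\<in>U - {j}. c i j) / (a - j) * F (X - {j})))"
  have col: "column_sum (a # vs) (replicate (length (a # vs)) True) False
        (\<lambda>hs' v. if v then exit_weight (us @ a # vs) (replicate (length us) True @ hs') es else 0) =
      a / (1 + a) * T + Q"
    unfolding Q_def T_def idle[symmetric] by (simp add: column_sum_full_below)
  have sum_insert: "(\<Sum>j\<in>insert a U. 1 / (1 + j) * (\<Prod>i\<in>insert a U - {j}. i / (1 + i) * c i j) * F (X - {j})) =
     (\<Sum>j\<in>U. 1 / (1 + j) * (\<Prod>i\<in>U - {j}. i / (1 + i) * c i j) * F (X - {j})) +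
     P * Q"
  proof -
    have "1 / (1 + j) * (\<Prod>i\<in>insert a U - {j}. i / (1 + i) * c i j) * F (X - {j}) =
      1 / (1 + j) * (\<Prod>i\<in>U - {j}. i / (1 + i) * c i j) * F (X - {j}) +
      P * (1 / (1 + a) * ((\<Prod>i\<in>U - {j}. c i j) / (a - j) * F (X - {j})))" if j: "j \<in> U" for j
    proof -
      have ne': "j \<noteq> a" "1 + j \<noteq> 0" using j ne Cons.prems(2) by (auto simp: U_def add_eq_0_iff)
      have "insert a U - {j} = insert a (U - {j})" using ne' by auto
      then have 1: "(\<Prod>i\<in>insert a U - {j}. i / (1 + i) * c i j) = a / (1 + a) * c a j * (\<Prod>i\<in>U - {j}. i / (1 + i) * c i j)"
        using ne by simp
      have 2: "P = j / (1 + j) * (\<Prod>i\<in>U-{j}. i / (1 + i))"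
        unfolding P_def using j by (simp add: prod.remove)
      have 3: "a / (1 + a) * c a j = 1 + j / ((1 + a) * (a - j))"
        using ne' ne by (simp add: c_def divide_simps) (simp add: algebra_simps)
      show ?thesis
        unfolding 1 3 2 unfolding prod.distrib
        by (simp only: divide_inverse inverse_mult_distrib) (simp add: algebra_simps)
    qed
    then have "(\<Sum>j\<in>U. 1 / (1 + j) * (\<Prod>i\<in>insert a U - {j}. i / (1 + i) * c i j) * F (X - {j})) =
      (\<Sum>j\<in>U. 1 / (1 + j) * (\<Prod>i\<in>U - {j}. i / (1 + i) * c i j) * F (X - {j})) +
      P * (1 / (1 + a) * (\<Sum>j\<in>U. (\<Prod>i\<in>U - {j}. c i j) / (a - j) * F (X - {j})))"
      by (simp add: sum.distrib sum_distrib_left)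
    moreover have "(\<Prod>i\<in>insert a U - {a}. i / (1 + i) * c i a) = P * (\<Prod>i\<in>U. c i a)"
      using ne(1) by (simp add: P_def prod.distrib[symmetric])
    ultimately show ?thesis
      using ne(1) by (simp add: Q_def distrib_left add_divide_distrib mult_ac)
  qed
  have prod_insert: "(\<Prod>i\<in>insert a U. i / (1 + i)) = P * (a / (1 + a))"
    using ne(1) by (simp add: P_def)
  have "(\<Sum>j\<in>U. 1 / (1 + j) * (\<Prod>i\<in>U - {j}. i / (1 + i) * c i j) * F (X - {j})) +
      P * column_sum (a # vs) (replicate (length (a # vs)) True) False
        (\<lambda>hs' v. if v then exit_weight (us @ a # vs) (replicate (length us) True @ hs') es else 0) =
    set_weight (True # es) X"
    using IH unfolding sum_insert prod_insert col by (simp only: distrib_left add_ac mult_ac)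
  then show ?case
    unfolding X c_def F_def P_def U_def .
qed

lemma column_sum_full_pass:
  "column_sum xs (replicate (length xs) True) False (\<lambda>hs' v. if v then 0 else f hs') =
    (\<Prod>x\<leftarrow>xs. x / (1 + x)) * f (replicate (length xs) True)"
proof (induction xs arbitrary: f)
  case (Cons x xs)
  have "column_sum xs (replicate (length xs) True) True (\<lambda>hs' v. if v then 0 else f (False # hs')) = 0"
    by (simp add: column_sum_full_below)
  with Cons[of "\<lambda>hs'. f (True # hs')"] show ?case by simp
qed simp

text \<open>The induction hypothesis about the remaining columns contains the symmetry in the rows
that \<open>exit_weight_one_idle\<close> requires.\<close>

lemma exit_weight_eq_set_weight:
  assumes "distinct xs" "-1 \<notin> set xs"
  shows "exit_weight xs (replicate (length xs) True) es = set_weight es (set xs)"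
  using assms
proof (induction es arbitrary: xs)
  case Nil
  then show ?case by (cases xs) auto
next
  case (Cons e es)
  show ?case
  proof (cases e)
    case True
    then show ?thesis
      using column_sum_full_exit[of es "[]" xs] Cons by (simp cong: if_cong)
  next
    case False
    have "(\<lambda>hs' v. if v = False then exit_weight xs hs' es else 0) =
          (\<lambda>hs' v. if v then 0 else exit_weight xs hs' es)"
      by (simp add: fun_eq_iff)
    then show ?thesis
      using column_sum_full_pass[of xs "\<lambda>hs'. exit_weight xs hs' es"] Cons False
      by (simp add: prod.distinct_set_conv_list)
  qed
qed

section \<open>Symmetrisation over enumerations\<close>

text \<open>The summand of \<^const>\<open>ssm_formula\<close> for exits \<open>is\<close> and the variables \<open>ys\<close> in the order in which the
permutation puts them. The value 0 for lists of different length is the right one: the exit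
weight vanishes if the number of exits differs from the number of paths.\<close>

fun enum_weight :: "nat list \<Rightarrow> real list \<Rightarrow> real" where
  "enum_weight [] [] = 1"
| "enum_weight (i # is) (y # ys) =
     y ^ (i - 1) / (1 + y) ^ i * (\<Prod>z\<leftarrow>ys. (1 + z - y) / (z - y)) * enum_weight is ys"
| "enum_weight _ _ = 0"

fun true_positions :: "nat \<Rightarrow> bool list \<Rightarrow> nat list" where
  "true_positions c [] = []"
| "true_positions c (e # es) = (if e then c # true_positions (Suc c) es else true_positions (Suc c) es)"

lemma sum_permutations_of_set_nonempty:
  assumes "finite X" "X \<noteq> {}"
  shows "(\<Sum>ys\<in>permutations_of_set X. f ys) =
    (\<Sum>a\<in>X. \<Sum>ys\<in>permutations_of_set (X - {a}). f (a # ys))"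
proof -
  have "(\<Sum>ys\<in>permutations_of_set X. f ys) =
      (\<Sum>a\<in>X. \<Sum>ys\<in>(#) a ` permutations_of_set (X - {a}). f ys)"
    unfolding permutations_of_set_nonempty[OF assms(2)]
    by (rule sum.UNION_disjoint) (use assms in auto)
  also have "\<dots> = (\<Sum>a\<in>X. \<Sum>ys\<in>permutations_of_set (X - {a}). f (a # ys))"
    by (simp add: sum.reindex)
  finally show ?thesis .
qed

text \<open>Both sides obey the same recursion on the columns. Starting the count of the columns at
\<open>Suc n\<close> instead of 1 multiplies the weight of each variable \<open>a\<close> by \<open>(a / (1 + a)) ^ n\<close>.\<close>

lemma sum_enum_weight_true_positions:
  assumes "finite X"
  shows "(\<Sum>ys\<in>permutations_of_set X. enum_weight (true_positions (Suc n) es) ys) =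
    (\<Prod>a\<in>X. (a / (1 + a)) ^ n) * set_weight es X"
  using assms
proof (induction es arbitrary: n X)
  case Nil
  show ?case
  proof (cases "X = {}")
    case False
    then have "enum_weight [] ys = 0" if "ys \<in> permutations_of_set X" for ys
      using that by (cases ys) (auto simp: permutations_of_set_def)
    then show ?thesis using False by simp
  qed simp
next
  case (Cons e es)
  show ?case
  proof (cases e)
    case False
    have "(\<Prod>a\<in>X. (a / (1 + a)) ^ Suc n) = (\<Prod>a\<in>X. a / (1 + a)) * (\<Prod>a\<in>X. (a / (1 + a)) ^ n)"
      by (simp only: power_Suc prod.distrib)
    with False show ?thesis by (simp add: Cons mult_ac del: power_Suc)
  next
    case True
    show ?thesis
    proof (cases "X = {}")
      case True
      with \<open>e\<close> show ?thesis by simp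
    next
      case False
      have "(\<Sum>ys\<in>permutations_of_set (X - {a}). enum_weight (true_positions (Suc n) (e # es)) (a # ys)) =
         (\<Prod>a\<in>X. (a / (1 + a)) ^ n) * (1 / (1 + a) * (\<Prod>b\<in>X - {a}. b / (1 + b) * ((1 + b - a) / (b - a))) *
        set_weight es (X - {a}))" if a: "a \<in> X" for a
      proof -
        have "(\<Sum>ys\<in>permutations_of_set (X - {a}). enum_weight (true_positions (Suc n) (e # es)) (a # ys)) =
          (\<Sum>ys\<in>permutations_of_set (X - {a}). (a / (1 + a)) ^ n * (1 / (1 + a)) *
             (\<Prod>z\<in>X - {a}. (1 + z - a) / (z - a)) * enum_weight (true_positions (Suc (Suc n)) es) ys)"
          using \<open>e\<close> by (intro sum.cong refl)
            (auto simp: prod.distinct_set_conv_list[symmetric] permutations_of_set_def power_divide)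
        also have "\<dots> = (a / (1 + a)) ^ n * (1 / (1 + a)) *
             (\<Prod>z\<in>X - {a}. (1 + z - a) / (z - a)) * ((\<Prod>a\<in>X - {a}. (a / (1 + a)) ^ Suc n) * set_weight es (X - {a}))"
          using Cons.prems by (subst sum_distrib_left[symmetric], subst Cons.IH) auto
        also have "\<dots> = ((a / (1 + a)) ^ n * (\<Prod>a\<in>X - {a}. (a / (1 + a)) ^ n)) * (1 / (1 + a) * (\<Prod>b\<in>X - {a}. b / (1 + b) * ((1 + b - a) / (b - a))) *
            set_weight es (X - {a}))"
          by (simp only: prod.distrib power_Suc mult_ac)
        also have "(a / (1 + a)) ^ n * (\<Prod>a\<in>X - {a}. (a / (1 + a)) ^ n) = (\<Prod>a\<in>X. (a / (1 + a)) ^ n)"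
          using prod.remove[OF Cons.prems a, of "\<lambda>a. (a / (1 + a)) ^ n"] by simp
        finally show ?thesis .
      qed
      then show ?thesis
        using \<open>e\<close> False Cons.prems
        by (simp add: sum_permutations_of_set_nonempty sum_distrib_left del: true_positions.simps)
    qed
  qed
qed

lemma enum_weight_map:
  "enum_weight (map i [1..<Suc m]) (map y [1..<Suc m]) =
     (\<Prod>u=1..m. y u ^ (i u - 1) / (1 + y u) ^ i u) *
     (\<Prod>(u, v) \<in> {(u, v). 1 \<le> u \<and> u < v \<and> v \<le> m}. (1 + y v - y u) / (y v - y u))"
proof -
  have "enum_weight (map i [k..<Suc m]) (map y [k..<Suc m]) =
     (\<Prod>u=k..m. y u ^ (i u - 1) / (1 + y u) ^ i u) *
     (\<Prod>u=k..m. \<Prod>v=Suc u..m. (1 + y v - y u) / (y v - y u))" if "k \<le> Suc m" for k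
    using that
  proof (induction k rule: inc_induct)
    case base
    then show ?case by simp
  next
    case (step k)
    then have "[k..<Suc m] = k # [Suc k..<Suc m]" and "{k..m} = insert k {Suc k..m}"
      by (auto simp: upt_conv_Cons simp del: upt_Suc)
    moreover have "(\<Prod>v\<leftarrow>map y [Suc k..<Suc m]. (1 + v - y k) / (v - y k)) = (\<Prod>v=Suc k..m. (1 + y v - y k) / (y v - y k))"
      by (simp add: prod.distinct_set_conv_list[symmetric] o_def atLeastLessThanSuc_atLeastAtMost del: upt_Suc)
    ultimately show ?case
      using step by (simp del: upt_Suc)
  qed
  from this[of 1] have "enum_weight (map i [1..<Suc m]) (map y [1..<Suc m]) =
     (\<Prod>u=1..m. y u ^ (i u - 1) / (1 + y u) ^ i u) *
     (\<Prod>u=1..m. \<Prod>v=Suc u..m. (1 + y v - y u) / (y v - y u))"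
    by simp
  also have "(\<Prod>u=1..m. \<Prod>v=Suc u..m. (1 + y v - y u) / (y v - y u)) =
     (\<Prod>(u, v) \<in> Sigma {1..m} (\<lambda>u. {Suc u..m}). (1 + y v - y u) / (y v - y u))"
    by (rule prod.Sigma) auto
  also have "Sigma {1..m} (\<lambda>u. {Suc u..m}) = {(u, v). 1 \<le> u \<and> u < v \<and> v \<le> m}"
    by auto
  finally show ?thesis .
qed

text \<open>For distinct values of the variables, permuting the indices is the same as listing the set of
values in some order.\<close>

lemma bij_betw_permutes_permutations_of_set:
  assumes "inj_on x {1..m}"
  shows "bij_betw (\<lambda>w. map (\<lambda>u. x (w u)) [1..<Suc m]) {w. w permutes {1..m}} (permutations_of_set (x ` {1..m}))"
    (is "bij_betw ?f ?P ?L")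
proof -
  have inj: "inj_on ?f ?P"
  proof (rule inj_onI)
    fix w w' assume w: "w \<in> ?P" "w' \<in> ?P" and eq: "?f w = ?f w'"
    show "w = w'"
    proof
      fix u
      show "w u = w' u"
      proof (cases "u \<in> {1..m}")
        case True
        then have "u \<in> set [1..<Suc m]" by auto
        with eq have "x (w u) = x (w' u)" by (simp only: map_eq_conv)
        moreover have "w u \<in> {1..m}" "w' u \<in> {1..m}"
          using True w permutes_in_image by (metis mem_Collect_eq)+
        ultimately show ?thesis using assms by (simp add: inj_on_eq_iff)
      next
        case False
        then show ?thesis using w by (simp add: permutes_not_in)
      qed
    qed
  qed
  moreover have "?f ` ?P = ?L"
  proof (rule card_subset_eq)
    show "?f ` ?P \<subseteq> ?L"
    proof safe
      fix w assume w: "w permutes {1..m}"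
      have s: "set [1..<Suc m] = {1..m}" by auto
      have "inj_on (\<lambda>u. x (w u)) {1..m}"
        using assms w comp_inj_on[of w "{1..m}" x] permutes_image[OF w]
        by (simp add: o_def permutes_inj_on)
      moreover have "(\<lambda>u. x (w u)) ` {1..m} = x ` {1..m}"
        using permutes_image[OF w] by (metis image_image)
      ultimately show "?f w \<in> ?L"
        unfolding permutations_of_set_def by (simp only: distinct_map s set_map distinct_upt mem_Collect_eq simp_thms)
    qed
    show "card (?f ` ?P) = card ?L"
      unfolding card_image[OF inj] using assms by (simp add: card_permutations card_image)
  qed simp
  ultimately show ?thesis by (simp add: bij_betw_def)
qed

text \<open>This is an identity of rational functions: negative variables are admitted.\<close>

lemma ssm_formula_eq_exit_weight:
  assumes "inj_on x {1..m}" "\<And>u. u \<in> {1..m} \<Longrightarrow> x u \<noteq> -1"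
    and "true_positions 1 es = map (position m l) [1..<Suc m]"
  shows "ssm_formula m l x = exit_weight (map x [1..<Suc m]) (replicate m True) es"
proof -
  have s: "set (map x [1..<Suc m]) = x ` {1..m}"
    by (auto simp: atLeastLessThanSuc_atLeastAtMost simp del: upt_Suc)
  have "ssm_formula m l x = (\<Sum>w | w permutes {1..m}.
       enum_weight (true_positions 1 es) (map (\<lambda>u. x (w u)) [1..<Suc m]))"
    unfolding ssm_formula_def assms(3) enum_weight_map ..
  also have "\<dots> = (\<Sum>ys\<in>permutations_of_set (x ` {1..m}). enum_weight (true_positions 1 es) ys)"
    by (rule sum.reindex_bij_betw[OF bij_betw_permutes_permutations_of_set[OF assms(1)]])
  also have "\<dots> = set_weight es (x ` {1..m})"
    using sum_enum_weight_true_positions[of "x ` {1..m}" 0 es] by simp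
  also have "\<dots> = exit_weight (map x [1..<Suc m]) (replicate m True) es"
    using exit_weight_eq_set_weight[of "map x [1..<Suc m]" es] assms(1,2)
    by (force simp: s distinct_map atLeastLessThanSuc_atLeastAtMost simp del: upt_Suc)
  finally show ?thesis .
qed

section \<open>Independence of the coins\<close>

definition depends_on :: "'i set \<Rightarrow> (('i \<Rightarrow> bool) \<Rightarrow> 'a) \<Rightarrow> bool" where
  "depends_on J f \<longleftrightarrow> (\<forall>\<omega> \<omega>'. (\<forall>j\<in>J. \<omega> j = \<omega>' j) \<longrightarrow> f \<omega> = f \<omega>')"

lemma depends_onD: "depends_on J f \<Longrightarrow> (\<And>j. j \<in> J \<Longrightarrow> \<omega> j = \<omega>' j) \<Longrightarrow> f \<omega> = f \<omega>'"
  unfolding depends_on_def by blast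

lemma measurable_depends_on:
  assumes "finite J" "J \<subseteq> I" "depends_on J A"
  shows "{\<omega> \<in> space (PiM I (\<lambda>i. measure_pmf (q i))). A \<omega>} \<in> sets (PiM I (\<lambda>i. measure_pmf (q i)))"
proof -
  let ?M = "PiM I (\<lambda>i. measure_pmf (q i))"
  have eq: "A \<omega> \<longleftrightarrow> (\<exists>T\<in>{T \<in> Pow J. A (\<lambda>j. j \<in> T)}. \<forall>j\<in>J. \<omega> j \<longleftrightarrow> j \<in> T)" for \<omega>
  proof -
    have restrict: "A \<omega> \<longleftrightarrow> A (\<lambda>j. j \<in> T)" if "\<forall>j\<in>J. \<omega> j \<longleftrightarrow> j \<in> T" for T
      by (rule depends_onD[OF assms(3)]) (use that in simp)
    show ?thesis
    proof
      assume "A \<omega>"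
      with restrict[of "{j \<in> J. \<omega> j}"] show "\<exists>T\<in>{T \<in> Pow J. A (\<lambda>j. j \<in> T)}. \<forall>j\<in>J. \<omega> j \<longleftrightarrow> j \<in> T"
        by (intro bexI[of _ "{j \<in> J. \<omega> j}"]) auto
    next
      assume "\<exists>T\<in>{T \<in> Pow J. A (\<lambda>j. j \<in> T)}. \<forall>j\<in>J. \<omega> j \<longleftrightarrow> j \<in> T"
      then obtain T where "A (\<lambda>j. j \<in> T)" "\<forall>j\<in>J. \<omega> j \<longleftrightarrow> j \<in> T" by auto
      with restrict[of T] show "A \<omega>" by simp
    qed
  qed
  have *: "{\<omega> \<in> space ?M. A \<omega>} =
      (\<Union>T\<in>{T \<in> Pow J. A (\<lambda>j. j \<in> T)}. {\<omega> \<in> space ?M. \<forall>j\<in>J. \<omega> j \<longleftrightarrow> j \<in> T})"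
    (is "?L = ?R")
  proof (rule set_eqI)
    fix \<omega>
    show "\<omega> \<in> ?L \<longleftrightarrow> \<omega> \<in> ?R" using eq[of \<omega>] by blast
  qed
  have "{\<omega> \<in> space ?M. \<forall>j\<in>J. \<omega> j \<longleftrightarrow> j \<in> T} \<in> sets ?M" for T
  proof (rule sets.sets_Collect_finite_All[OF _ assms(1)])
    fix j assume "j \<in> J"
    with assms(2) have j: "j \<in> I" by auto
    have "(\<lambda>\<omega>. \<omega> j) -` {j \<in> T} \<inter> space ?M \<in> sets ?M"
      by (rule measurable_sets[OF measurable_component_singleton[OF j]]) simp
    moreover have "(\<lambda>\<omega>. \<omega> j) -` {j \<in> T} \<inter> space ?M = {\<omega> \<in> space ?M. \<omega> j \<longleftrightarrow> j \<in> T}"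
      by auto
    ultimately show "{\<omega> \<in> space ?M. \<omega> j \<longleftrightarrow> j \<in> T} \<in> sets ?M" by simp
  qed
  then show ?thesis
    unfolding * using assms(1) by (intro sets.finite_UN) auto
qed

text \<open>The infinite product measure is the product of the law of the coordinate \<open>j\<close> and of the product
over all other coordinates; events that do not look at \<open>j\<close> only concern the second factor.\<close>

lemma measure_coordinate_independent:
  fixes q :: "'i \<Rightarrow> bool pmf" and I :: "'i set"
  defines "M \<equiv> PiM I (\<lambda>i. measure_pmf (q i))"
  assumes "finite J" "J \<subseteq> I" "j \<in> I" "j \<notin> J" "depends_on J A"
  shows "measure M {\<omega> \<in> space M. \<omega> j = b \<and> A \<omega>} = pmf (q j) b * measure M {\<omega> \<in> space M. A \<omega>}"
proof -
  define M' where "M' = PiM (I - {j}) (\<lambda>i. measure_pmf (q i))"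
  define B where "B = {X \<in> space M'. A X}"
  have ins: "insert j (I - {j}) = I" using assms(4) by auto
  interpret M': prob_space M'
    unfolding M'_def by (rule prob_space_PiM) (rule measure_pmf.prob_space_axioms)
  have M: "M = distr (measure_pmf (q j) \<Otimes>\<^sub>M M') M (\<lambda>(y, X). X(j := y))"
    using distr_pair_PiM_eq_PiM[of "I - {j}" "\<lambda>i. measure_pmf (q i)" j]
    unfolding ins M_def M'_def by (simp add: measure_pmf.prob_space_axioms)
  have meas: "(\<lambda>(y, X). X(j := y)) \<in> measurable (measure_pmf (q j) \<Otimes>\<^sub>M M') M"
    unfolding M_def M'_def case_prod_beta'
    by (rule measurable_fun_upd[where J = "I - {j}"]) (use assms(4) in \<open>blast intro: measurable_fst measurable_snd\<close>)+
  have B: "B \<in> sets M'"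
    unfolding B_def M'_def by (rule measurable_depends_on[of J]) (use assms(2-6) in auto)
  have A: "A (X(j := y)) \<longleftrightarrow> A X" for X y
    by (rule depends_onD[OF assms(6)]) (use assms(5) in auto)
  have sp: "X(j := y) \<in> space M" if "X \<in> space M'" for X y
    using that ins by (auto simp: M_def M'_def space_PiM PiE_def extensional_def)
  have *: "measure M {\<omega> \<in> space M. \<omega> j \<in> C \<and> A \<omega>} = measure_pmf.prob (q j) C * measure M' B"
    if C: "{\<omega> \<in> space M. \<omega> j \<in> C \<and> A \<omega>} \<in> sets M" for C
  proof -
    have "measure M {\<omega> \<in> space M. \<omega> j \<in> C \<and> A \<omega>} =
      measure (measure_pmf (q j) \<Otimes>\<^sub>M M')
       ((\<lambda>(y, X). X(j := y)) -` {\<omega> \<in> space M. \<omega> j \<in> C \<and> A \<omega>} \<inter> space (measure_pmf (q j) \<Otimes>\<^sub>M M'))"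
      using measure_distr[OF meas C] unfolding M[symmetric] .
    also have "(\<lambda>(y, X). X(j := y)) -` {\<omega> \<in> space M. \<omega> j \<in> C \<and> A \<omega>} \<inter> space (measure_pmf (q j) \<Otimes>\<^sub>M M')
        = C \<times> B"
      by (auto simp: A B_def sp space_pair_measure)
    also have "measure (measure_pmf (q j) \<Otimes>\<^sub>M M') (C \<times> B) = measure_pmf.prob (q j) C * measure M' B"
      using B by (simp add: measure_def M'.emeasure_pair_measure_Times enn2real_mult)
    finally show ?thesis .
  qed
  have "{\<omega> \<in> space M. \<omega> j \<in> {b} \<and> A \<omega>} \<in> sets M"
    unfolding M_def
  proof (rule measurable_depends_on)
    show "depends_on (insert j J) (\<lambda>\<omega>. \<omega> j \<in> {b} \<and> A \<omega>)"
      using assms(6) unfolding depends_on_def by blast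
  qed (use assms(2-4) in auto)
  moreover have "{\<omega> \<in> space M. \<omega> j \<in> UNIV \<and> A \<omega>} \<in> sets M"
    unfolding M_def
    by (rule measurable_depends_on[of J]) (use assms(2,3,6) in auto)
  ultimately have "measure M {\<omega> \<in> space M. \<omega> j \<in> {b} \<and> A \<omega>} = measure_pmf.prob (q j) {b} * measure M' B"
      "measure M {\<omega> \<in> space M. \<omega> j \<in> UNIV \<and> A \<omega>} = measure_pmf.prob (q j) UNIV * measure M' B"
    by (blast intro: *)+
  moreover have "measure_pmf.prob (q j) UNIV = 1"
    using measure_pmf.prob_space[of "q j"] by simp
  ultimately show ?thesis
    by (simp add: measure_pmf_single)
qed

section \<open>The law of the exits\<close>

fun column_run :: "bool list \<Rightarrow> bool list \<Rightarrow> bool \<Rightarrow> bool list \<times> bool" where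
  "column_run (k # ks) (h # hs) v =
     (let (h', v') = vertex k (h, v); (hs', v'') = column_run ks hs v' in (h' # hs', v''))"
| "column_run _ _ v = ([], v)"

text \<open>The coins of the column \<open>c\<close> are integrated out one row at a time, from bottom to top. What happens
later, \<open>\<Phi>\<close>, depends on finitely many coins \<open>J\<close> in other columns, so that the coin of the bottom row
is independent of everything else.\<close>

lemma prob_column_run:
  fixes m :: nat and p :: "nat \<Rightarrow> real"
    and \<Phi> :: "(nat \<times> nat \<Rightarrow> bool) \<Rightarrow> bool list \<Rightarrow> bool \<Rightarrow> bool"
  defines "Pr \<equiv> \<lambda>A. \<P>(\<omega> in six_vertex m p. A \<omega>)"
  assumes x: "\<And>u. u \<in> {1..m} \<Longrightarrow> x u \<ge> 0" "\<And>u. u \<in> {1..m} \<Longrightarrow> p u = x u / (1 + x u)"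
    and J: "finite J" "J \<subseteq> {1..m} \<times> {1..}" "J \<inter> UNIV \<times> {c} = {}" "c \<ge> 1"
    and rs: "distinct rs" "set rs \<subseteq> {1..m}"
    and \<Phi>: "\<And>hs' v'. depends_on J (\<lambda>\<omega>. \<Phi> \<omega> hs' v')"
  shows "Pr (\<lambda>\<omega>. case column_run (map (\<lambda>u. \<omega> (u, c)) rs) hs v of (hs', v') \<Rightarrow> \<Phi> \<omega> hs' v') =
    column_sum (map x rs) hs v (\<lambda>hs' v'. Pr (\<lambda>\<omega>. \<Phi> \<omega> hs' v'))"
  using rs \<Phi>
proof (induction rs arbitrary: hs v \<Phi>)
  case Nil
  then show ?case by simp
next
  case (Cons r rs)
  show ?case
  proof (cases hs)
    case Nil
    then show ?thesis by simp
  next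
    case hs: (Cons h hs')
    define B where "B b \<omega> = (case column_run (map (\<lambda>u. \<omega> (u, c)) rs) hs' (if b then v else h) of
        (hs'', v') \<Rightarrow> \<Phi> \<omega> ((if b then h else v) # hs'') v')" for b \<omega>
    have B: "Pr (B b) = column_sum (map x rs) hs' (if b then v else h)
        (\<lambda>hs'' v'. Pr (\<lambda>\<omega>. \<Phi> \<omega> ((if b then h else v) # hs'') v'))" for b
    proof -
      have "B b = (\<lambda>\<omega>. case column_run (map (\<lambda>u. \<omega> (u, c)) rs) hs' (if b then v else h) of
        (hs'', v') \<Rightarrow> \<Phi> \<omega> ((if b then h else v) # hs'') v')"
        by (rule ext) (rule B_def)
      then show ?thesis
        using Cons.IH[where \<Phi> = "\<lambda>\<omega> hs''. \<Phi> \<omega> ((if b then h else v) # hs'')"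
            and hs = hs' and v = "if b then v else h"] Cons.prems by simp
    qed
    have step: "(case column_run (map (\<lambda>u. \<omega> (u, c)) (r # rs)) hs v of (hs', v') \<Rightarrow> \<Phi> \<omega> hs' v') \<longleftrightarrow>
        B (\<omega> (r, c) \<or> h = v) \<omega>" for \<omega>
      by (cases "\<omega> (r, c)"; cases "h = v") (simp_all add: hs B_def Let_def case_prod_beta')
    show ?thesis
    proof (cases "h = v")
      case True
      then show ?thesis
        using B[of True] unfolding step by (simp add: hs)
    next
      case False
      define M where "M = six_vertex m p"
      define q where "q = (\<lambda>i::nat \<times> nat. bernoulli_pmf (p (fst i)))"
      have M: "M = PiM ({1..m} \<times> {1..}) (\<lambda>i. measure_pmf (q i))"
        by (simp add: M_def six_vertex_def q_def case_prod_beta')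
      have r: "(r, c) \<in> {1..m} \<times> {1..}" "x r \<ge> 0" "p r = x r / (1 + x r)"
        using Cons.prems J(4) x by auto
      have fin: "finite (J \<union> set rs \<times> {c})" "J \<union> set rs \<times> {c} \<subseteq> {1..m} \<times> {1..}"
          "(r, c) \<notin> J \<union> set rs \<times> {c}"
        using J Cons.prems by auto
      have dep: "depends_on (J \<union> set rs \<times> {c}) (B b)" for b
        unfolding depends_on_def
      proof (intro allI impI)
        fix \<omega> \<omega>' :: "nat \<times> nat \<Rightarrow> bool"
        assume eq: "\<forall>j\<in>J \<union> set rs \<times> {c}. \<omega> j = \<omega>' j"
        then have "map (\<lambda>u. \<omega> (u, c)) rs = map (\<lambda>u. \<omega>' (u, c)) rs" by auto
        moreover have "\<Phi> \<omega> hs' v' = \<Phi> \<omega>' hs' v'" for hs' v'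
          by (rule depends_onD[OF Cons.prems(3)]) (use eq in auto)
        ultimately show "B b \<omega> = B b \<omega>'" by (simp only: B_def)
      qed
      interpret prob_space M
        unfolding M by (rule prob_space_PiM) (rule measure_pmf.prob_space_axioms)
      have coin: "measure M {\<omega> \<in> space M. \<omega> (r, c) = b \<and> B b \<omega>} =
          pmf (q (r, c)) b * measure M {\<omega> \<in> space M. B b \<omega>}" for b
        unfolding M by (rule measure_coordinate_independent[OF fin(1,2) r(1) fin(3) dep])
      have sets: "{\<omega> \<in> space M. \<omega> (r, c) = b \<and> B b \<omega>} \<in> sets M" for b
        unfolding M by (rule measurable_depends_on[of "insert (r, c) (J \<union> set rs \<times> {c})"])
          (use fin r dep[of b] in \<open>auto simp: depends_on_def\<close>)
      have p01: "0 \<le> p r" "p r \<le> 1" using r by simp_all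
      have split: "B (\<omega> (r, c)) \<omega> \<longleftrightarrow> \<omega> (r, c) = True \<and> B True \<omega> \<or> \<omega> (r, c) = False \<and> B False \<omega>" for \<omega>
        by (cases "\<omega> (r, c)") simp_all
      have "measure M {\<omega> \<in> space M. B (\<omega> (r, c)) \<omega>} =
         measure M ({\<omega> \<in> space M. \<omega> (r, c) = True \<and> B True \<omega>} \<union>
           {\<omega> \<in> space M. \<omega> (r, c) = False \<and> B False \<omega>})"
        by (rule arg_cong[where f = "measure M"], rule set_eqI)
          (simp only: split mem_Collect_eq Un_iff, blast)
      also have "\<dots> = measure M {\<omega> \<in> space M. \<omega> (r, c) = True \<and> B True \<omega>} +
         measure M {\<omega> \<in> space M. \<omega> (r, c) = False \<and> B False \<omega>}"
        by (rule finite_measure_Union[OF sets[of True] sets[of False]]) auto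
      also have "\<dots> = p r * Pr (B True) + (1 - p r) * Pr (B False)"
        unfolding coin using p01 by (simp add: q_def Pr_def M_def)
      also have "1 - p r = 1 / (1 + x r)" using r by (simp add: field_simps)
      finally have "measure M {\<omega> \<in> space M. B (\<omega> (r, c)) \<omega>} = column_sum (map x (r # rs)) hs v
          (\<lambda>hs' v'. Pr (\<lambda>\<omega>. \<Phi> \<omega> hs' v'))"
        unfolding B using False r by (simp add: hs)
      then show ?thesis
        unfolding step using False by (simp add: Pr_def M_def)
    qed
  qed
qed

text \<open>The event whose probability is \<^const>\<open>exit_weight\<close>; \<open>c\<close> is the column that emits the first bit.\<close>

fun exits_match :: "nat list \<Rightarrow> (nat \<times> nat \<Rightarrow> bool) \<Rightarrow> nat \<Rightarrow> bool list \<Rightarrow> bool list \<Rightarrow> bool" where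
  "exits_match rs \<omega> c hs [] \<longleftrightarrow> True \<notin> set hs"
| "exits_match rs \<omega> c hs (e # es) \<longleftrightarrow>
     (case column_run (map (\<lambda>u. \<omega> (u, c)) rs) hs False of
        (hs', v) \<Rightarrow> v = e \<and> exits_match rs \<omega> (Suc c) hs' es)"

lemma depends_on_exits_match:
  "depends_on (set rs \<times> {c..<c + length es}) (\<lambda>\<omega>. exits_match rs \<omega> c hs es)"
proof (induction es arbitrary: c hs)
  case (Cons e es)
  show ?case
    unfolding depends_on_def
  proof (intro allI impI)
    fix \<omega> \<omega>' :: "nat \<times> nat \<Rightarrow> bool"
    assume eq: "\<forall>j\<in>set rs \<times> {c..<c + length (e # es)}. \<omega> j = \<omega>' j"
    then have "map (\<lambda>u. \<omega> (u, c)) rs = map (\<lambda>u. \<omega>' (u, c)) rs" by auto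
    moreover have "exits_match rs \<omega> (Suc c) hs' es = exits_match rs \<omega>' (Suc c) hs' es" for hs'
      by (rule depends_onD[OF Cons]) (use eq in auto)
    ultimately show "exits_match rs \<omega> c hs (e # es) = exits_match rs \<omega>' c hs (e # es)"
      by (simp only: exits_match.simps)
  qed
qed (simp add: depends_on_def)

lemma prob_exits_match:
  assumes x: "\<And>u. u \<in> {1..m} \<Longrightarrow> x u \<ge> 0" "\<And>u. u \<in> {1..m} \<Longrightarrow> p u = x u / (1 + x u)"
    and rs: "distinct rs" "set rs \<subseteq> {1..m}" and "c \<ge> 1"
  shows "\<P>(\<omega> in six_vertex m p. exits_match rs \<omega> c hs es) = exit_weight (map x rs) hs es"
  using assms(5)
proof (induction es arbitrary: c hs)
  case Nil
  interpret prob_space "six_vertex m p"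
    unfolding six_vertex_def by (rule prob_space_PiM) (auto intro: measure_pmf.prob_space_axioms)
  show ?case by (simp add: prob_space)
next
  case (Cons e es)
  have "\<P>(\<omega> in six_vertex m p. exits_match rs \<omega> c hs (e # es)) =
      column_sum (map x rs) hs False
        (\<lambda>hs' v. \<P>(\<omega> in six_vertex m p. v = e \<and> exits_match rs \<omega> (Suc c) hs' es))"
    unfolding exits_match.simps
  proof (rule prob_column_run[OF x _ _ _ Cons.prems rs, where J = "set rs \<times> {Suc c..<Suc c + length es}"])
    show "depends_on (set rs \<times> {Suc c..<Suc c + length es}) (\<lambda>\<omega>. v' = e \<and> exits_match rs \<omega> (Suc c) hs' es)" for hs' v'
      using depends_on_exits_match[of rs "Suc c" es hs'] unfolding depends_on_def by blast
  qed (use rs Cons.prems in auto)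
  also have "\<dots> = exit_weight (map x rs) hs (e # es)"
    unfolding exit_weight.simps by (rule column_sum_cong) (use Cons in auto)
  finally show ?case .
qed

section \<open>From rows to columns\<close>

text \<open>The model is updated row by row, but each vertex only needs its left and its lower neighbour.
The horizontal edges to the right of the column \<open>c\<close>, read from bottom to top, are the state when
the same configuration is built column by column.\<close>

definition right_edges :: "(nat \<times> nat \<Rightarrow> bool) \<Rightarrow> nat \<Rightarrow> nat \<Rightarrow> bool list" where
  "right_edges \<omega> m c = map (\<lambda>u. horizontal (\<lambda>c'. \<omega> (u, c')) (vertical \<omega> (u - 1)) c) [1..<Suc m]"

lemma column_run_snoc:
  assumes "length ks = length hs"
  shows "column_run (ks @ [k]) (hs @ [h]) v =
    (let (hs', v') = column_run ks hs v; (h', v'') = vertex k (h, v') in (hs' @ [h'], v''))"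
  using assms
  by (induction ks hs arbitrary: v rule: list_induct2)
    (simp_all add: Let_def case_prod_beta' del: vertex.simps)

lemma column_run_right_edges:
  "column_run (map (\<lambda>u. \<omega> (u, Suc c)) [1..<Suc m]) (right_edges \<omega> m c) False =
    (right_edges \<omega> m (Suc c), vertical \<omega> m (Suc c))"
proof (induction m)
  case 0
  then show ?case by (simp add: right_edges_def)
next
  case (Suc m)
  have "right_edges \<omega> (Suc m) c' =
      right_edges \<omega> m c' @ [horizontal (\<lambda>c'. \<omega> (Suc m, c')) (vertical \<omega> m) c']" for c'
    by (simp add: right_edges_def)
  moreover have "[1..<Suc (Suc m)] = [1..<Suc m] @ [Suc m]" by simp
  moreover have "length (map (\<lambda>u. \<omega> (u, Suc c)) [1..<Suc m]) = length (right_edges \<omega> m c)"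
    by (simp add: right_edges_def)
  ultimately show ?case
    using Suc by (simp add: column_run_snoc case_prod_beta' Let_def del: upt_Suc)
qed

lemma right_edges_0: "right_edges \<omega> m 0 = replicate m True"
  by (simp add: right_edges_def map_replicate_const del: upt_Suc)

lemma column_run_conserves_paths:
  assumes "length ks = length hs"
  shows "count_list (fst (column_run ks hs v)) True + of_bool (snd (column_run ks hs v)) =
    count_list hs True + of_bool v"
  using assms
proof (induction ks hs arbitrary: v rule: list_induct2)
  case (Cons k ks h hs)
  show ?case
    using Cons.IH[of True] Cons.IH[of False]
    by (cases k; cases h; cases v) (simp_all add: case_prod_beta' Let_def)
qed simp

lemma right_edges_step_count:
  "count_list (right_edges \<omega> m (Suc c)) True + of_bool (vertical \<omega> m (Suc c)) =
     count_list (right_edges \<omega> m c) True"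
  using column_run_conserves_paths[of "map (\<lambda>u. \<omega> (u, Suc c)) [1..<Suc m]" "right_edges \<omega> m c" False]
  unfolding column_run_right_edges by (simp add: right_edges_def)

lemma count_right_edges:
  "count_list (right_edges \<omega> m c) True + card (exits m \<omega> \<inter> {1..c}) = m"
proof (induction c)
  case 0
  have "count_list (replicate m True) True = m" by (induction m) auto
  then show ?case by (simp add: right_edges_0)
next
  case (Suc c)
  have "exits m \<omega> \<inter> {1..Suc c} =
      (if vertical \<omega> m (Suc c) then insert (Suc c) (exits m \<omega> \<inter> {1..c}) else exits m \<omega> \<inter> {1..c})"
    by (auto simp: exits_def le_Suc_eq)
  then show ?case
    using Suc right_edges_step_count[of \<omega> m c] by (auto split: if_splits)
qed

lemma exits_match_right_edges:
  "exits_match [1..<Suc m] \<omega> (Suc c) (right_edges \<omega> m c) es \<longleftrightarrow>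
    (\<forall>i<length es. vertical \<omega> m (Suc c + i) = es ! i) \<and> True \<notin> set (right_edges \<omega> m (c + length es))"
proof (induction es arbitrary: c)
  case (Cons e es)
  have "(\<forall>i<length (e # es). vertical \<omega> m (Suc c + i) = (e # es) ! i) \<longleftrightarrow>
      vertical \<omega> m (Suc c) = e \<and> (\<forall>i<length es. vertical \<omega> m (Suc (Suc c) + i) = es ! i)"
    by (simp add: All_less_Suc2)
  then show ?case
    unfolding exits_match.simps column_run_right_edges prod.case Cons by simp
qed simp

text \<open>The exit set is an event about all columns, but paths are conserved: when \<open>m\<close> exits have occurred
up to the column \<open>N\<close>, all horizontal edges after \<open>N\<close> are empty, and no further exit is possible.
Hence the event is decided by the first \<open>N\<close> columns.\<close>

lemma exits_eq_iff_exits_match: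
  assumes "S \<subseteq> {1..N}" "card S = m"
  shows "exits m \<omega> = S \<longleftrightarrow>
    exits_match [1..<Suc m] \<omega> 1 (replicate m True) (map (\<lambda>c. c \<in> S) [1..<Suc N])"
proof -
  have bits: "(\<forall>i<length (map (\<lambda>c. c \<in> S) [1..<Suc N]). vertical \<omega> m (Suc 0 + i) = map (\<lambda>c. c \<in> S) [1..<Suc N] ! i)
      \<longleftrightarrow> exits m \<omega> \<inter> {1..N} = S"
  proof -
    have "(\<forall>i<length (map (\<lambda>c. c \<in> S) [1..<Suc N]). vertical \<omega> m (Suc 0 + i) = map (\<lambda>c. c \<in> S) [1..<Suc N] ! i)
      \<longleftrightarrow> (\<forall>i<N. vertical \<omega> m (Suc i) \<longleftrightarrow> Suc i \<in> S)"
      by (simp del: upt_Suc)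
    also have "\<dots> \<longleftrightarrow> (\<forall>c\<in>{1..N}. vertical \<omega> m c \<longleftrightarrow> c \<in> S)"
    proof -
      have "{1..N} = Suc ` {..<N}" by (simp add: image_Suc_lessThan)
      then show ?thesis by auto
    qed
    also have "\<dots> \<longleftrightarrow> exits m \<omega> \<inter> {1..N} = S"
      using assms(1) by (auto simp: exits_def)
    finally show ?thesis .
  qed
  have "exits m \<omega> = S \<longleftrightarrow> exits m \<omega> \<inter> {1..N} = S \<and> True \<notin> set (right_edges \<omega> m N)"
  proof
    assume "exits m \<omega> = S"
    with assms count_right_edges[of \<omega> m N] have "count_list (right_edges \<omega> m N) True = 0"
      by (simp add: Int_absorb2)
    with \<open>exits m \<omega> = S\<close> assms show "exits m \<omega> \<inter> {1..N} = S \<and> True \<notin> set (right_edges \<omega> m N)"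
      by (auto simp: count_list_0_iff)
  next
    assume asm: "exits m \<omega> \<inter> {1..N} = S \<and> True \<notin> set (right_edges \<omega> m N)"
    have "count_list (right_edges \<omega> m c) True = 0" if "N \<le> c" for c
      using that
    proof (induction c rule: dec_induct)
      case base
      then show ?case using asm by (simp add: count_list_0_iff)
    next
      case (step c)
      then show ?case using right_edges_step_count[of \<omega> m c] by simp
    qed
    then have "\<not> vertical \<omega> m (Suc c)" if "N \<le> c" for c
      using right_edges_step_count[of \<omega> m c] that by (metis add_is_0 of_bool_eq_0_iff)
    then have "c \<le> N" if "vertical \<omega> m c" "1 \<le> c" for c
      using that by (cases c) (auto simp: Suc_le_eq not_le[symmetric])
    then have "exits m \<omega> \<subseteq> {1..N}"
      by (auto simp: exits_def)
    with asm show "exits m \<omega> = S" by auto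
  qed
  then show ?thesis
    using exits_match_right_edges[of m \<omega> 0 "map (\<lambda>c. c \<in> S) [1..<Suc N]"] bits
    by (simp add: right_edges_0 del: upt_Suc)
qed

lemma position_less:
  assumes "is_partition l" "1 \<le> a" "a < b" "b \<le> m"
  shows "position m l a < position m l b"
proof -
  have "part l (m + 1 - a) \<le> part l (m + 1 - b)"
    using assms by (intro part_antimono) auto
  with assms show ?thesis by (simp add: position_def)
qed

text \<open>Both lists enumerate \<open>S\<close> increasingly.\<close>

lemma true_positions_position:
  fixes m :: nat and l :: "nat list"
  assumes "is_partition l"
  defines "S \<equiv> position m l ` {1..m}"
  assumes "S \<subseteq> {1..N}"
  shows "true_positions 1 (map (\<lambda>c. c \<in> S) [1..<Suc N]) = map (position m l) [1..<Suc m]"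
proof (rule sorted_distinct_set_unique)
  have true_positions: "true_positions k (map P [k..<n]) = filter P [k..<n]" for k n P
  proof (induction "n - k" arbitrary: k)
    case (Suc d)
    then have "[k..<n] = k # [Suc k..<n]" by (simp add: upt_conv_Cons)
    with Suc(1)[of "Suc k"] Suc(2) show ?case by simp
  qed simp
  show "set (true_positions 1 (map (\<lambda>c. c \<in> S) [1..<Suc N])) = set (map (position m l) [1..<Suc m])"
  proof -
    have sets: "set [1..<Suc n] = {1..n}" for n by auto
    have "{c \<in> {1..N}. c \<in> S} = S" using assms(3) by blast
    then show ?thesis unfolding true_positions set_filter set_map sets S_def .
  qed
  show "sorted (true_positions 1 (map (\<lambda>c. c \<in> S) [1..<Suc N]))" "distinct (true_positions 1 (map (\<lambda>c. c \<in> S) [1..<Suc N]))"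
    unfolding true_positions by (simp_all add: sorted_wrt_filter del: upt_Suc)
  have "sorted_wrt (<) (map (position m l) [1..<Suc m])"
    using position_less[OF assms(1)] by (auto simp: sorted_wrt_iff_nth_less simp del: upt_Suc)
  then show "sorted (map (position m l) [1..<Suc m])" "distinct (map (position m l) [1..<Suc m])"
    by (simp_all only: strict_sorted_iff)
qed

section \<open>Coinciding parameters\<close>

lemma tendsto_column_sum:
  assumes "\<And>u. u \<in> set rs \<Longrightarrow> ((\<lambda>y. y u) \<longlongrightarrow> x u) F" "\<And>u. u \<in> set rs \<Longrightarrow> 1 + x u \<noteq> 0"
    and "\<And>hs' v'. ((\<lambda>y. f y hs' v') \<longlongrightarrow> g hs' v') F"
  shows "((\<lambda>y. column_sum (map y rs) hs v (f y)) \<longlongrightarrow> column_sum (map x rs) hs v g) F"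
  using assms
proof (induction rs arbitrary: hs v f g)
  case (Cons r rs)
  show ?case
  proof (cases hs)
    case Nil
    with Cons.prems show ?thesis by simp
  next
    case hs: (Cons h hs')
    have "((\<lambda>y. column_sum (map y rs) hs' v' (\<lambda>hs''. f y (h' # hs''))) \<longlongrightarrow>
        column_sum (map x rs) hs' v' (\<lambda>hs''. g (h' # hs''))) F" for v' h'
      by (rule Cons.IH) (use Cons.prems in auto)
    moreover have "((\<lambda>y. y r) \<longlongrightarrow> x r) F" "1 + x r \<noteq> 0" using Cons.prems by auto
    ultimately show ?thesis
      unfolding hs list.map column_sum.simps
      by (cases "h = v") (simp_all only: if_True if_False, auto intro!: tendsto_intros)
  qed
qed simp

lemma tendsto_exit_weight:
  assumes "\<And>u. u \<in> set rs \<Longrightarrow> ((\<lambda>y. y u) \<longlongrightarrow> x u) F" "\<And>u. u \<in> set rs \<Longrightarrow> 1 + x u \<noteq> 0"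
  shows "((\<lambda>y. exit_weight (map y rs) hs es) \<longlongrightarrow> exit_weight (map x rs) hs es) F"
proof (induction es arbitrary: hs)
  case (Cons e es)
  show ?case
    unfolding exit_weight.simps
    by (rule tendsto_column_sum[OF assms]) (simp_all add: Cons)
qed simp

text \<open>The points \<open>x i + i / (n + 1)\<close> have distinct coordinates for large \<open>n\<close>, also when some of the \<open>x i\<close>
coincide.\<close>

lemma injective_points_limit:
  assumes "m \<ge> 1"
  shows "at (x :: nat \<Rightarrow> real) within {y. inj_on y {1..m}} \<noteq> bot"
proof -
  define y where "y n i = x i + real i * inverse (real (Suc n))" for n i
  have lim: "(\<lambda>n. y n i) \<longlonglongrightarrow> x i" for i
    unfolding y_def using tendsto_add[OF tendsto_const tendsto_mult[OF tendsto_const LIMSEQ_inverse_real_of_nat], of "x i" "real i"]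
    by simp
  then have "y \<longlonglongrightarrow> x"
    using limitin_componentwise[of "\<lambda>_. euclidean" UNIV y x sequentially]
    by (simp add: euclidean_product_topology)
  moreover have "\<forall>\<^sub>F n in sequentially. y n \<in> {y. inj_on y {1..m}}"
  proof -
    have distinct: "\<forall>\<^sub>F n in sequentially. y n i \<noteq> y n j" if "i \<noteq> j" for i j
    proof (cases "x i = x j")
      case True
      with that show ?thesis by (simp add: y_def)
    next
      case False
      have "(\<lambda>n. y n i - y n j) \<longlonglongrightarrow> x i - x j" by (intro tendsto_intros lim)
      then have "\<forall>\<^sub>F n in sequentially. y n i - y n j \<noteq> 0"
        using False by (intro tendsto_imp_eventually_ne) auto
      then show ?thesis by simp
    qed
    have "\<forall>\<^sub>F n in sequentially. \<forall>i\<in>{1..m}. \<forall>j\<in>{1..m}. i \<noteq> j \<longrightarrow> y n i \<noteq> y n j"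
    proof (intro eventually_ball_finite ballI)
      show "\<forall>\<^sub>F n in sequentially. i \<noteq> j \<longrightarrow> y n i \<noteq> y n j" for i j
        using distinct[of i j] by (cases "i = j") simp_all
    qed simp_all
    then show ?thesis
    proof eventually_elim
      fix n assume "\<forall>i\<in>{1..m}. \<forall>j\<in>{1..m}. i \<noteq> j \<longrightarrow> y n i \<noteq> y n j"
      then show "y n \<in> {y. inj_on y {1..m}}"
        unfolding mem_Collect_eq by (intro inj_onI) blast
    qed
  qed
  \<comment> \<open>The filter is punctured at \<open>x\<close>; the coordinate 1 is moved at every step.\<close>
  moreover have "y n \<noteq> x" for n
  proof
    assume "y n = x"
    then have "y n 1 = x 1" by simp
    then show False by (simp add: y_def)
  qed
  ultimately have "filterlim y (at x within {y. inj_on y {1..m}}) sequentially"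
    by (simp add: filterlim_at)
  then show ?thesis
    by (auto simp: filterlim_def bot_unique filtermap_bot_iff)
qed

text \<open>The exit weight is a rational function with poles only where a variable is \<open>-1\<close>, and it agrees with
\<^const>\<open>ssm_formula\<close> off the diagonals, so it is the continuous extension of the formula.\<close>

lemma ssm_eq_exit_weight:
  assumes "m \<ge> 1" "\<And>u. u \<in> {1..m} \<Longrightarrow> x u \<noteq> -1"
    and "true_positions 1 es = map (position m l) [1..<Suc m]"
  shows "ssm m l x = exit_weight (map x [1..<Suc m]) (replicate m True) es"
proof -
  let ?F = "at x within {y. inj_on y {1..m}}"
  have coord: "((\<lambda>y. y i) \<longlongrightarrow> x i) ?F" for i
    using continuous_on_product_coordinates[of i]
    by (auto simp: continuous_on_def intro: tendsto_within_subset)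
  have "((\<lambda>y. exit_weight (map y [1..<Suc m]) (replicate m True) es) \<longlongrightarrow>
      exit_weight (map x [1..<Suc m]) (replicate m True) es) ?F"
  proof (rule tendsto_exit_weight[OF coord])
    fix u assume "u \<in> set [1..<Suc m]"
    then have "x u \<noteq> -1" by (intro assms(2)) auto
    then show "1 + x u \<noteq> 0" by (simp add: add_eq_0_iff)
  qed
  moreover have "\<forall>\<^sub>F y in ?F. exit_weight (map y [1..<Suc m]) (replicate m True) es = ssm_formula m l y"
  proof -
    have "\<forall>\<^sub>F y in ?F. \<forall>u\<in>{1..m}. y u \<noteq> -1"
      using tendsto_imp_eventually_ne[OF coord assms(2)] by (intro eventually_ball_finite) auto
    moreover have "\<forall>\<^sub>F y in ?F. inj_on y {1..m}"
      by (simp add: eventually_at_filter)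
    ultimately show ?thesis
      by eventually_elim (rule ssm_formula_eq_exit_weight[OF _ _ assms(3), symmetric], blast+)
  qed
  ultimately have "(ssm_formula m l \<longlongrightarrow> exit_weight (map x [1..<Suc m]) (replicate m True) es) ?F"
    by (rule Lim_transform_eventually)
  then show ?thesis
    unfolding ssm_def by (rule tendsto_Lim[OF injective_points_limit[OF assms(1)]])
qed

section \<open>The law of the random partition\<close>

theorem theorem1p1:
  fixes m :: nat and x p :: "nat \<Rightarrow> real" and l :: "nat list"
  assumes "m \<ge> 1"
    and "\<And>i. i \<in> {1..m} \<Longrightarrow> x i \<ge> 0"
    and "\<And>i. i \<in> {1..m} \<Longrightarrow> p i = x i / (1 + x i)"
    and "is_partition l" and "length l \<le> m"
  shows "\<P>(\<omega> in six_vertex m p. exit_partition m \<omega> = Some l) = ssm m l x"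
proof -
  define S where "S = position m l ` {1..m}"
  define N where "N = Max S"
  define es where "es = map (\<lambda>c. c \<in> S) [1..<Suc N]"
  have S: "S \<subseteq> {1..N}"
  proof
    fix c assume "c \<in> S"
    moreover from this have "1 \<le> c" by (auto simp: S_def position_def)
    ultimately show "c \<in> {1..N}" by (simp add: N_def S_def)
  qed
  have "inj_on (position m l) {1..m}"
    by (rule linorder_inj_onI) (use position_less[OF assms(4)] in fastforce)+
  then have card: "card S = m" by (simp add: S_def card_image)
  have "exit_partition m \<omega> = Some l \<longleftrightarrow> exits_match [1..<Suc m] \<omega> 1 (replicate m True) es" for \<omega>
    using exit_partition_eq_Some_iff[OF assms(4,5)] exits_eq_iff_exits_match[OF S card]
    unfolding S_def es_def by blast
  then have "\<P>(\<omega> in six_vertex m p. exit_partition m \<omega> = Some l) =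
      \<P>(\<omega> in six_vertex m p. exits_match [1..<Suc m] \<omega> 1 (replicate m True) es)"
    by simp
  also have "\<dots> = exit_weight (map x [1..<Suc m]) (replicate m True) es"
    by (rule prob_exits_match[OF assms(2,3)]) auto
  also have "\<dots> = ssm m l x"
  proof (rule ssm_eq_exit_weight[symmetric, OF assms(1)])
    show "true_positions 1 es = map (position m l) [1..<Suc m]"
      using true_positions_position[OF assms(4), of m N] S unfolding S_def es_def by blast
    show "x u \<noteq> -1" if "u \<in> {1..m}" for u
      using assms(2)[OF that] by linarith
  qed
  finally show ?thesis .
qed

end
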